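(* For all $p\in[1,\infty)$, all $m=1,2,\ldots$ and all complex $m\times m$ matrices $A$ with $\|A\|\le1$, $$\inf_{T\in L_{\mathrm n}}\|A-T\|\ \le\ \inf_{T\in L_{\mathrm n}:\,\|T\|\le\|A\|}\|A-T\|\ \le\ F\bigl(\|[A^*,A]\|\bigr)$$ and $$\inf_{T\in L_{\mathrm n}}\|A-T\|_p\ \le\ \inf_{T\in L_{\mathrm n}:\,\|T\|\le\|A\|}\|A-T\|_p\ \le\ m^{1/p}\,F\bigl(m^{-1/p}\|[A^*,A]\|_p\bigr),$$ where $L_{\mathrm n}$ is the set of normal $m\times m$ matrices.
   Context: $\|\cdot\|$ is the operator norm and $\|\cdot\|_p$ the Schatten $p$-norm on $m\times m$ matrices; $[A^*,A]=A^*A-AA^*$. The function $F$: for a unital $C^*$-algebra $L\subseteq\mathcal B(H)$ with $I\in L$, let $L^{-1}$ be the set of invertible elements, $L_0^{-1}$ the connected component of $L^{-1}$ containing $I$, $L_{\mathrm n}$ and $L_{\mathrm s}$ the sets of normal and self-adjoint elements; a bar denotes norm closure; $L$ has real rank zero if $\overline{L^{-1}\cap L_{\mathrm s}}=L_{\mathrm s}$; $A\in L$ satisfies condition (C) if $A-\lambda I\in\overline{L_0^{-1}}$ for all $\lambda\in\mathbb C$; $B_L(r):=\{T\in L:\|T\|\le r\}$; $M_T$ is the convex hull of $\{S_1TS_2:S_1,S_2\in B_L(1)\}$. Fix a nonincreasing function $h:(0,\infty)\to[0,\infty)$ with $h(\varepsilon)=0$ for $\varepsilon\ge1$ such that $A\in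 (B_L(\|A\|)\cap L_{\mathrm n})+(h(\varepsilon)M_{[A^*,A]}\cap L_{\mathrm s})+B_L(\varepsilon)$ for all $\varepsilon>0$, all unital $C^*$-algebras $L$ of real rank zero and all $A\in L$ with $\|A\|\le1$ satisfying (C) (the paper proves that such $h$ exists), and set $F(t):=\inf_{\varepsilon>0}(h(\varepsilon)t+\varepsilon)$ for $t\in[0,\infty)$. *)

theory Defs
  imports "HOL-Analysis.Analysis"
begin

section \<open>Complex Hilbert spaces on a carrier set\<close>

text \<open>
  The hypothesis on \<open>h\<close> ranges over all Hilbert spaces, and HOL formulas cannot quantify over
  types. Hilbert spaces are therefore structures on arbitrary carrier subsets of a type, so that
  they can be quantified over. The type must be large enough to carry such structures: a nonzero
  Hilbert space has at least continuum many elements.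
  The inner product is linear in its first argument.
\<close>

record 'u hilbert =
  car :: "'u set"
  zer :: 'u
  add :: "'u \<Rightarrow> 'u \<Rightarrow> 'u"
  scl :: "complex \<Rightarrow> 'u \<Rightarrow> 'u"
  inn :: "'u \<Rightarrow> 'u \<Rightarrow> complex"

definition hnorm :: "'u hilbert \<Rightarrow> 'u \<Rightarrow> real" where
  "hnorm H x = sqrt (Re (inn H x x))"

text \<open>
  \<^locale>\<open>Metric_space\<close> asks for nonnegativity and symmetry on the whole type, not only on the
  carrier; hence the value 0 outside of the carrier, here and for operators below.
\<close>

definition hdist :: "'u hilbert \<Rightarrow> 'u \<Rightarrow> 'u \<Rightarrow> real" where
  "hdist H x y = (if x \<in> car H \<and> y \<in> car H then hnorm H (add H x (scl H (-1) y)) else 0)"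

locale complex_pre_hilbert =
  fixes H :: "'u hilbert"
  assumes zer_closed: "zer H \<in> car H"
    and add_closed: "\<lbrakk>x \<in> car H; y \<in> car H\<rbrakk> \<Longrightarrow> add H x y \<in> car H"
    and scl_closed: "x \<in> car H \<Longrightarrow> scl H a x \<in> car H"
    and add_assoc: "\<lbrakk>x \<in> car H; y \<in> car H; z \<in> car H\<rbrakk>
          \<Longrightarrow> add H (add H x y) z = add H x (add H y z)"
    and add_commute: "\<lbrakk>x \<in> car H; y \<in> car H\<rbrakk> \<Longrightarrow> add H x y = add H y x"
    and add_zer: "x \<in> car H \<Longrightarrow> add H (zer H) x = x"
    and add_neg: "x \<in> car H \<Longrightarrow> \<exists>y\<in>car H. add H x y = zer H"
    and scl_add_right: "\<lbrakk>x \<in> car H; y \<in> car H\<rbrakk>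
          \<Longrightarrow> scl H a (add H x y) = add H (scl H a x) (scl H a y)"
    and scl_add_left: "x \<in> car H \<Longrightarrow> scl H (a + b) x = add H (scl H a x) (scl H b x)"
    and scl_scl: "x \<in> car H \<Longrightarrow> scl H a (scl H b x) = scl H (a * b) x"
    and scl_one: "x \<in> car H \<Longrightarrow> scl H 1 x = x"
    and inn_add: "\<lbrakk>x \<in> car H; y \<in> car H; z \<in> car H\<rbrakk>
          \<Longrightarrow> inn H (add H x y) z = inn H x z + inn H y z"
    and inn_scl: "\<lbrakk>x \<in> car H; y \<in> car H\<rbrakk> \<Longrightarrow> inn H (scl H a x) y = a * inn H x y"
    and inn_commute: "\<lbrakk>x \<in> car H; y \<in> car H\<rbrakk> \<Longrightarrow> inn H x y = cnj (inn H y x)"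
    and inn_nonneg: "x \<in> car H \<Longrightarrow> 0 \<le> Re (inn H x x)"
    and inn_eq_0: "\<lbrakk>x \<in> car H; inn H x x = 0\<rbrakk> \<Longrightarrow> x = zer H"
context complex_pre_hilbert
begin

lemma inn_add_right:
  assumes x: "x \<in> car H" and y: "y \<in> car H" and z: "z \<in> car H"
  shows "inn H x (add H y z) = inn H x y + inn H x z"
  using inn_commute[OF x add_closed[OF y z]] inn_commute[OF x y] inn_commute[OF x z]
    inn_add[OF y z x] by (simp only: complex_cnj_add)

lemma inn_scl_right:
  assumes x: "x \<in> car H" and y: "y \<in> car H"
  shows "inn H x (scl H a y) = cnj a * inn H x y"
  using inn_commute[OF x scl_closed[OF y]] inn_commute[OF x y] inn_scl[OF y x]
  by (simp only: complex_cnj_mult)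

lemma Im_inn_self: "x \<in> car H \<Longrightarrow> Im (inn H x x) = 0"
  using arg_cong[where f = Im, OF inn_commute[of x x]] by simp

lemma inn_self: "x \<in> car H \<Longrightarrow> inn H x x = of_real (Re (inn H x x))"
  by (rule complex_eqI) (simp_all add: Im_inn_self)

lemma hnorm_nonneg: "x \<in> car H \<Longrightarrow> 0 \<le> hnorm H x"
  by (simp add: hnorm_def inn_nonneg)

lemma hnorm_sq: "x \<in> car H \<Longrightarrow> (hnorm H x)\<^sup>2 = Re (inn H x x)"
  by (simp add: hnorm_def inn_nonneg)

lemma scl_zero: "x \<in> car H \<Longrightarrow> scl H 0 x = zer H"
  by (rule inn_eq_0) (simp_all add: scl_closed inn_scl)

lemma hnorm_eq_0: "x \<in> car H \<Longrightarrow> hnorm H x = 0 \<longleftrightarrow> x = zer H"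
proof
  assume x: "x \<in> car H" and "hnorm H x = 0"
  then show "x = zer H"
    using Im_inn_self[OF x] by (intro inn_eq_0) (auto simp: hnorm_def complex_eq_iff)
next
  assume x: "x \<in> car H" and "x = zer H"
  then show "hnorm H x = 0"
    using scl_zero[OF x] inn_scl[OF x x, of 0] by (simp add: hnorm_def)
qed

lemma hnorm_scl: "x \<in> car H \<Longrightarrow> hnorm H (scl H a x) = cmod a * hnorm H x"
proof -
  assume x: "x \<in> car H"
  have "inn H (scl H a x) (scl H a x) = (a * cnj a) * inn H x x"
    using x by (simp add: inn_scl inn_scl_right scl_closed)
  also have "a * cnj a = of_real ((cmod a)\<^sup>2)"
    by (metis complex_norm_square)
  finally show ?thesis
    by (simp add: hnorm_def real_sqrt_mult)
qed

lemma cauchy_schwarz: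
  assumes x: "x \<in> car H" and y: "y \<in> car H"
  shows "cmod (inn H x y) \<le> hnorm H x * hnorm H y"
proof (cases "y = zer H")
  case True
  then have "inn H x y = 0"
    using inn_scl_right[OF x y, of 0] scl_zero[OF y] by simp
  then show ?thesis
    using x y by (simp add: hnorm_nonneg)
next
  case False
  define n where "n = Re (inn H y y)"
  have "n \<noteq> 0"
  proof
    assume "n = 0"
    then have "inn H y y = 0"
      using Im_inn_self[OF y] by (simp add: n_def complex_eq_iff)
    with False inn_eq_0[OF y] show False
      by blast
  qed
  then have n: "0 < n"
    using inn_nonneg[OF y] unfolding n_def by linarith
  define c where "c = inn H x y / of_real n"
  define z where "z = add H x (scl H (- c) y)"
  have z: "z \<in> car H"
    unfolding z_def by (intro add_closed scl_closed x y)
  have yy: "inn H y y = of_real n"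
    unfolding n_def by (rule inn_self[OF y])
  have yx: "inn H y x = cnj (inn H x y)"
    using inn_commute[OF y x] .
  have "inn H z z = inn H x x + cnj (- c) * inn H x y + (- c) * (inn H y x + cnj (- c) * inn H y y)"
    unfolding z_def using x y
    by (simp add: inn_add inn_add_right inn_scl inn_scl_right scl_closed add_closed algebra_simps)
  also have "\<dots> = inn H x x - (inn H x y * cnj (inn H x y)) / of_real n"
    using n by (simp add: yy yx c_def field_simps)
  also have "\<dots> = inn H x x - of_real ((cmod (inn H x y))\<^sup>2 / n)"
    by (simp add: complex_norm_square[symmetric])
  finally have "Re (inn H z z) = Re (inn H x x) - (cmod (inn H x y))\<^sup>2 / n"
    by (metis Re_complex_of_real minus_complex.simps(1))
  then have "(cmod (inn H x y))\<^sup>2 / n \<le> Re (inn H x x)"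
    using inn_nonneg[OF z] by simp
  then have "(cmod (inn H x y))\<^sup>2 \<le> Re (inn H x x) * n"
    using n by (simp only: pos_divide_le_eq)
  also have "\<dots> = (hnorm H x * hnorm H y)\<^sup>2"
    using x y by (simp add: power_mult_distrib hnorm_sq n_def)
  finally show ?thesis
    by (rule power2_le_imp_le) (simp add: x y hnorm_nonneg)
qed

lemma hnorm_triangle:
  assumes x: "x \<in> car H" and y: "y \<in> car H"
  shows "hnorm H (add H x y) \<le> hnorm H x + hnorm H y"
proof (rule power2_le_imp_le)
  have "(hnorm H (add H x y))\<^sup>2 = Re (inn H x x) + Re (inn H y y) + 2 * Re (inn H x y)"
    using x y inn_commute[OF y x]
    by (simp add: hnorm_sq add_closed inn_add inn_add_right)
  also have "\<dots> \<le> (hnorm H x)\<^sup>2 + (hnorm H y)\<^sup>2 + 2 * (hnorm H x * hnorm H y)"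
    using cauchy_schwarz[OF x y] complex_Re_le_cmod[of "inn H x y"] x y
    by (simp add: hnorm_sq)
  finally show "(hnorm H (add H x y))\<^sup>2 \<le> (hnorm H x + hnorm H y)\<^sup>2"
    by (simp add: power2_sum)
qed (simp add: x y hnorm_nonneg)

lemma add_zer_right:
  assumes "x \<in> car H"
  shows "add H x (zer H) = x"
  using add_commute[OF assms zer_closed] add_zer[OF assms] by (rule trans)

lemma add_scl_minus:
  assumes x: "x \<in> car H"
  shows "add H x (scl H (-1) x) = zer H"
proof -
  have "add H x (scl H (-1) x) = scl H (1 + -1) x"
    using scl_add_left[OF x, of 1 "-1", symmetric] by (simp only: scl_one[OF x])
  then show ?thesis
    using scl_zero[OF x] by simp
qed

lemma scl_minus_add:
  assumes x: "x \<in> car H"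
  shows "add H (scl H (-1) x) x = zer H"
  using add_commute[OF scl_closed[OF x] x] add_scl_minus[OF x] by (rule trans)

lemma diff_eq_zer:
  assumes "x \<in> car H" "y \<in> car H"
  shows "add H x (scl H (-1) y) = zer H \<longleftrightarrow> x = y"
proof
  assume eq: "add H x (scl H (-1) y) = zer H"
  have "x = add H x (add H (scl H (-1) y) y)"
    by (simp add: assms scl_minus_add add_zer_right)
  also have "\<dots> = add H (add H x (scl H (-1) y)) y"
    using assms by (intro add_assoc[symmetric] scl_closed)
  finally show "x = y"
    using assms by (simp add: eq add_zer)
qed (use assms in \<open>simp add: add_scl_minus\<close>)

lemma diff_commute:
  assumes "x \<in> car H" "y \<in> car H"
  shows "add H y (scl H (-1) x) = scl H (-1) (add H x (scl H (-1) y))"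
  using assms by (simp add: scl_add_right scl_closed scl_scl scl_one add_commute)

lemma diff_split:
  assumes x: "x \<in> car H" and y: "y \<in> car H" and z: "z \<in> car H"
  shows "add H x (scl H (-1) z) = add H (add H x (scl H (-1) y)) (add H y (scl H (-1) z))"
proof -
  have "add H (add H x (scl H (-1) y)) (add H y (scl H (-1) z))
      = add H x (add H (add H (scl H (-1) y) y) (scl H (-1) z))"
    using x y z by (simp add: add_assoc add_closed scl_closed)
  then show ?thesis
    using x y z by (simp add: scl_minus_add add_zer scl_closed)
qed

lemma Metric_space_hdist: "Metric_space (car H) (hdist H)"
proof
  fix x y
  show "0 \<le> hdist H x y"
    by (auto simp: hdist_def intro!: hnorm_nonneg add_closed scl_closed)
  show "hdist H x y = hdist H y x"
    by (auto simp: hdist_def diff_commute[of x y] hnorm_scl add_closed scl_closed)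
next
  fix x y assume "x \<in> car H" "y \<in> car H"
  then show "hdist H x y = 0 \<longleftrightarrow> x = y"
    by (simp add: hdist_def hnorm_eq_0 add_closed scl_closed diff_eq_zer)
next
  fix x y z assume "x \<in> car H" "y \<in> car H" "z \<in> car H"
  then show "hdist H x z \<le> hdist H x y + hdist H y z"
    by (simp add: hdist_def diff_split[of x y z] hnorm_triangle add_closed scl_closed)
qed

end

locale complex_hilbert = complex_pre_hilbert +
  assumes complete: "Metric_space.mcomplete (car H) (hdist H)"


section \<open>Bounded operators\<close>

text \<open>Operators are extensional functions on the carrier, so that equality of operators is
  equality in HOL.\<close>

definition bounded_ops :: "'u hilbert \<Rightarrow> ('u \<Rightarrow> 'u) set" where
  "bounded_ops H = {T \<in> car H \<rightarrow>\<^sub>E car H.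
     (\<forall>x\<in>car H. \<forall>y\<in>car H. T (add H x y) = add H (T x) (T y)) \<and>
     (\<forall>a. \<forall>x\<in>car H. T (scl H a x) = scl H a (T x)) \<and>
     (\<exists>K. \<forall>x\<in>car H. hnorm H (T x) \<le> K * hnorm H x)}"

definition op_id :: "'u hilbert \<Rightarrow> 'u \<Rightarrow> 'u" where
  "op_id H = (\<lambda>x\<in>car H. x)"

definition op_add :: "'u hilbert \<Rightarrow> ('u \<Rightarrow> 'u) \<Rightarrow> ('u \<Rightarrow> 'u) \<Rightarrow> 'u \<Rightarrow> 'u" where
  "op_add H S T = (\<lambda>x\<in>car H. add H (S x) (T x))"

definition op_scale :: "'u hilbert \<Rightarrow> complex \<Rightarrow> ('u \<Rightarrow> 'u) \<Rightarrow> 'u \<Rightarrow> 'u" where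
  "op_scale H a T = (\<lambda>x\<in>car H. scl H a (T x))"

definition op_diff :: "'u hilbert \<Rightarrow> ('u \<Rightarrow> 'u) \<Rightarrow> ('u \<Rightarrow> 'u) \<Rightarrow> 'u \<Rightarrow> 'u" where
  "op_diff H S T = op_add H S (op_scale H (-1) T)"

definition op_mult :: "'u hilbert \<Rightarrow> ('u \<Rightarrow> 'u) \<Rightarrow> ('u \<Rightarrow> 'u) \<Rightarrow> 'u \<Rightarrow> 'u" where
  "op_mult H S T = compose (car H) S T"

definition op_norm :: "'u hilbert \<Rightarrow> ('u \<Rightarrow> 'u) \<Rightarrow> real" where
  "op_norm H T = (SUP x\<in>{x \<in> car H. hnorm H x \<le> 1}. hnorm H (T x))"

definition op_adj :: "'u hilbert \<Rightarrow> ('u \<Rightarrow> 'u) \<Rightarrow> 'u \<Rightarrow> 'u" where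
  "op_adj H T = (THE S. S \<in> bounded_ops H \<and>
     (\<forall>x\<in>car H. \<forall>y\<in>car H. inn H (T x) y = inn H x (S y)))"

definition op_commutator :: "'u hilbert \<Rightarrow> ('u \<Rightarrow> 'u) \<Rightarrow> ('u \<Rightarrow> 'u) \<Rightarrow> 'u \<Rightarrow> 'u" where
  "op_commutator H S T = op_diff H (op_mult H S T) (op_mult H T S)"

definition op_dist :: "'u hilbert \<Rightarrow> ('u \<Rightarrow> 'u) \<Rightarrow> ('u \<Rightarrow> 'u) \<Rightarrow> real" where
  "op_dist H S T =
     (if S \<in> bounded_ops H \<and> T \<in> bounded_ops H then op_norm H (op_diff H S T) else 0)"

definition op_topology :: "'u hilbert \<Rightarrow> ('u \<Rightarrow> 'u) topology" where
  "op_topology H = Metric_space.mtopology (bounded_ops H) (op_dist H)"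
context complex_pre_hilbert
begin

lemma bounded_opsD:
  assumes "T \<in> bounded_ops H"
  shows "x \<in> car H \<Longrightarrow> T x \<in> car H"
    and "\<lbrakk>x \<in> car H; y \<in> car H\<rbrakk> \<Longrightarrow> T (add H x y) = add H (T x) (T y)"
    and "x \<in> car H \<Longrightarrow> T (scl H a x) = scl H a (T x)"
  using assms by (auto simp: bounded_ops_def)

lemma op_add_closed:
  assumes S: "S \<in> bounded_ops H" and T: "T \<in> bounded_ops H"
  shows "op_add H S T \<in> bounded_ops H"
proof -
  obtain K1 where K1: "\<And>x. x \<in> car H \<Longrightarrow> hnorm H (S x) \<le> K1 * hnorm H x"
    using S unfolding bounded_ops_def by blast
  obtain K2 where K2: "\<And>x. x \<in> car H \<Longrightarrow> hnorm H (T x) \<le> K2 * hnorm H x"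
    using T unfolding bounded_ops_def by blast
  have "hnorm H (op_add H S T x) \<le> (K1 + K2) * hnorm H x" if x: "x \<in> car H" for x
    using hnorm_triangle[of "S x" "T x"] K1[OF x] K2[OF x] x bounded_opsD(1)[OF S x] bounded_opsD(1)[OF T x]
    by (simp add: op_add_def distrib_right)
  moreover have "op_add H S T (add H x y) = add H (op_add H S T x) (op_add H S T y)"
    if x: "x \<in> car H" and y: "y \<in> car H" for x y
  proof -
    note c = bounded_opsD(1)[OF S x] bounded_opsD(1)[OF T x]
      bounded_opsD(1)[OF S y] bounded_opsD(1)[OF T y]
    have "add H (add H (S x) (S y)) (add H (T x) (T y))
        = add H (S x) (add H (S y) (add H (T x) (T y)))"
      using c by (simp add: add_assoc add_closed)
    also have "add H (S y) (add H (T x) (T y)) = add H (T x) (add H (S y) (T y))"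
      using c add_assoc[of "S y" "T x" "T y"] add_assoc[of "T x" "S y" "T y"]
        add_commute[of "S y" "T x"] by simp
    also have "add H (S x) (add H (T x) (add H (S y) (T y)))
        = add H (add H (S x) (T x)) (add H (S y) (T y))"
      using c by (simp add: add_assoc add_closed)
    finally show ?thesis
      using x y by (simp add: op_add_def add_closed bounded_opsD(2)[OF S] bounded_opsD(2)[OF T])
  qed
  moreover have "op_add H S T (scl H a x) = scl H a (op_add H S T x)" if x: "x \<in> car H" for a x
    using x bounded_opsD(1)[OF S x] bounded_opsD(1)[OF T x]
    by (simp add: op_add_def scl_closed scl_add_right bounded_opsD(3)[OF S] bounded_opsD(3)[OF T])
  moreover have "op_add H S T \<in> car H \<rightarrow>\<^sub>E car H"
    using bounded_opsD(1)[OF S] bounded_opsD(1)[OF T] by (auto simp: op_add_def add_closed)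
  ultimately show ?thesis
    unfolding bounded_ops_def by blast
qed

lemma op_scale_closed:
  assumes T: "T \<in> bounded_ops H"
  shows "op_scale H a T \<in> bounded_ops H"
proof -
  obtain K where K: "\<And>x. x \<in> car H \<Longrightarrow> hnorm H (T x) \<le> K * hnorm H x"
    using T unfolding bounded_ops_def by blast
  have "hnorm H (op_scale H a T x) \<le> (cmod a * K) * hnorm H x" if x: "x \<in> car H" for x
    using x bounded_opsD(1)[OF T x] mult_left_mono[OF K[OF x], of "cmod a"]
    by (simp add: op_scale_def hnorm_scl mult.assoc)
  moreover have "op_scale H a T \<in> car H \<rightarrow>\<^sub>E car H"
    using bounded_opsD(1)[OF T] by (auto simp: op_scale_def scl_closed)
  moreover have "op_scale H a T (add H x y) = add H (op_scale H a T x) (op_scale H a T y)"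
    if x: "x \<in> car H" and y: "y \<in> car H" for x y
    using x y bounded_opsD(1)[OF T]
    by (simp add: op_scale_def add_closed scl_add_right bounded_opsD(2)[OF T])
  moreover have "op_scale H a T (scl H b x) = scl H b (op_scale H a T x)"
    if x: "x \<in> car H" for b x
    using x bounded_opsD(1)[OF T]
    by (simp add: op_scale_def scl_closed scl_scl bounded_opsD(3)[OF T] mult.commute)
  ultimately show ?thesis
    unfolding bounded_ops_def by blast
qed

lemma op_diff_closed:
  "\<lbrakk>S \<in> bounded_ops H; T \<in> bounded_ops H\<rbrakk> \<Longrightarrow> op_diff H S T \<in> bounded_ops H"
  by (simp add: op_diff_def op_add_closed op_scale_closed)

lemma bounded_op_zer: "T \<in> bounded_ops H \<Longrightarrow> T (zer H) = zer H"
  using bounded_opsD(3)[of T "zer H" 0] bounded_opsD(1)[of T "zer H"]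
  by (simp add: zer_closed scl_zero)

lemma hnorm_zer: "hnorm H (zer H) = 0"
  by (simp add: hnorm_eq_0 zer_closed)

lemma bdd_above_op_norm:
  assumes T: "T \<in> bounded_ops H"
  shows "bdd_above ((\<lambda>x. hnorm H (T x)) ` {x \<in> car H. hnorm H x \<le> 1})"
proof -
  obtain K where K: "\<And>x. x \<in> car H \<Longrightarrow> hnorm H (T x) \<le> K * hnorm H x"
    using T unfolding bounded_ops_def by blast
  have "hnorm H (T x) \<le> \<bar>K\<bar>" if "x \<in> car H" "hnorm H x \<le> 1" for x
  proof -
    have "K * hnorm H x \<le> \<bar>K\<bar> * hnorm H x"
      using hnorm_nonneg[OF that(1)] by (simp add: mult_right_mono)
    also have "\<dots> \<le> \<bar>K\<bar>"
      using mult_left_mono[OF that(2), of "\<bar>K\<bar>"] by simp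
    finally show ?thesis
      using K[OF that(1)] by simp
  qed
  then show ?thesis
    by (intro bdd_aboveI2[where M = "\<bar>K\<bar>"]) auto
qed

lemma op_norm_upper:
  assumes "T \<in> bounded_ops H" "x \<in> car H" "hnorm H x \<le> 1"
  shows "hnorm H (T x) \<le> op_norm H T"
  unfolding op_norm_def using assms by (intro cSUP_upper bdd_above_op_norm) auto

lemma op_norm_least:
  assumes "\<And>x. \<lbrakk>x \<in> car H; hnorm H x \<le> 1\<rbrakk> \<Longrightarrow> hnorm H (T x) \<le> b"
  shows "op_norm H T \<le> b"
  unfolding op_norm_def using assms zer_closed hnorm_zer by (intro cSUP_least) auto

lemma op_norm_nonneg: "T \<in> bounded_ops H \<Longrightarrow> 0 \<le> op_norm H T"
  using op_norm_upper[OF _ zer_closed] by (simp add: bounded_op_zer hnorm_zer)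

lemma hnorm_op_le:
  assumes T: "T \<in> bounded_ops H" and x: "x \<in> car H"
  shows "hnorm H (T x) \<le> op_norm H T * hnorm H x"
proof (cases "x = zer H")
  case True
  then show ?thesis
    by (simp add: bounded_op_zer[OF T] hnorm_zer)
next
  case False
  then have pos: "0 < hnorm H x"
    using hnorm_nonneg[OF x] hnorm_eq_0[OF x] by linarith
  define y where "y = scl H (of_real (inverse (hnorm H x))) x"
  have y: "y \<in> car H" "hnorm H y \<le> 1"
    using pos x by (simp_all add: y_def scl_closed hnorm_scl norm_inverse)
  have "hnorm H (T y) = inverse (hnorm H x) * hnorm H (T x)"
    using pos x bounded_opsD(1)[OF T x]
    by (simp add: y_def bounded_opsD(3)[OF T] hnorm_scl norm_inverse)
  then show ?thesis
    using mult_left_mono[OF op_norm_upper[OF T y], of "hnorm H x"] pos by (simp add: field_simps)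
qed

lemma Metric_space_op_dist: "Metric_space (bounded_ops H) (op_dist H)"
proof
  fix S T
  show "0 \<le> op_dist H S T"
    by (simp add: op_dist_def op_norm_nonneg op_diff_closed)
  have "hnorm H (op_diff H S T x) = hnorm H (op_diff H T S x)"
    if "S \<in> bounded_ops H" "T \<in> bounded_ops H" "x \<in> car H" for x
    using that bounded_opsD(1)[OF that(1,3)] bounded_opsD(1)[OF that(2,3)]
    by (simp add: op_diff_def op_add_def op_scale_def diff_commute[of "S x" "T x"]
        hnorm_scl add_closed scl_closed)
  then show "op_dist H S T = op_dist H T S"
    by (auto simp: op_dist_def op_norm_def intro!: SUP_cong)
next
  fix S T assume S: "S \<in> bounded_ops H" and T: "T \<in> bounded_ops H"
  note D = op_diff_closed[OF S T]
  have diff: "op_diff H S T x = add H (S x) (scl H (-1) (T x))" if "x \<in> car H" for x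
    using that by (simp add: op_diff_def op_add_def op_scale_def)
  have diff_zer: "op_diff H S T x = zer H \<longleftrightarrow> S x = T x" if x: "x \<in> car H" for x
    using diff[OF x] diff_eq_zer bounded_opsD(1)[OF S x] bounded_opsD(1)[OF T x] by simp
  show "op_dist H S T = 0 \<longleftrightarrow> S = T"
  proof
    assume "op_dist H S T = 0"
    then have "op_norm H (op_diff H S T) = 0"
      using S T by (simp add: op_dist_def)
    then have "hnorm H (op_diff H S T x) = 0" if "x \<in> car H" for x
      using hnorm_op_le[OF D that] hnorm_nonneg[OF bounded_opsD(1)[OF D that]] by simp
    then have "S x = T x" if "x \<in> car H" for x
      using that diff_zer hnorm_eq_0 bounded_opsD(1)[OF D] by blast
    then show "S = T"
      using S T unfolding bounded_ops_def by (intro extensionalityI[of S "car H"]) (auto simp: PiE_def)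
  next
    assume eq: "S = T"
    have "op_norm H (op_diff H S T) \<le> 0"
      using diff_zer eq by (intro op_norm_least) (simp add: hnorm_zer)
    then show "op_dist H S T = 0"
      using op_norm_nonneg[OF D] S T by (simp add: op_dist_def)
  qed
next
  fix R S T assume R: "R \<in> bounded_ops H" and S: "S \<in> bounded_ops H" and T: "T \<in> bounded_ops H"
  have "op_norm H (op_diff H R T) \<le> op_norm H (op_diff H R S) + op_norm H (op_diff H S T)"
  proof (rule op_norm_least)
    fix x assume x: "x \<in> car H" "hnorm H x \<le> 1"
    have "op_diff H R T x = add H (op_diff H R S x) (op_diff H S T x)"
      using x diff_split[of "R x" "S x" "T x"] bounded_opsD(1)[OF R] bounded_opsD(1)[OF S]
        bounded_opsD(1)[OF T] by (simp add: op_diff_def op_add_def op_scale_def)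
    then have "hnorm H (op_diff H R T x) \<le> hnorm H (op_diff H R S x) + hnorm H (op_diff H S T x)"
      using hnorm_triangle bounded_opsD(1)[OF op_diff_closed[OF R S] x(1)]
        bounded_opsD(1)[OF op_diff_closed[OF S T] x(1)] by simp
    also have "\<dots> \<le> op_norm H (op_diff H R S) + op_norm H (op_diff H S T)"
      using op_norm_upper[OF op_diff_closed[OF R S] x] op_norm_upper[OF op_diff_closed[OF S T] x]
      by simp
    finally show "hnorm H (op_diff H R T x)
        \<le> op_norm H (op_diff H R S) + op_norm H (op_diff H S T)" .
  qed
  then show "op_dist H R T \<le> op_dist H R S + op_dist H S T"
    using R S T by (simp add: op_dist_def)
qed

end

definition op_convex :: "'u hilbert \<Rightarrow> ('u \<Rightarrow> 'u) set \<Rightarrow> bool" where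
  "op_convex H C \<longleftrightarrow> (\<forall>S\<in>C. \<forall>T\<in>C. \<forall>u\<ge>0. \<forall>v\<ge>0. u + v = (1::real) \<longrightarrow>
     op_add H (op_scale H (of_real u) S) (op_scale H (of_real v) T) \<in> C)"


section \<open>Unital C*-algebras of operators\<close>

definition unital_cstar_algebra :: "'u hilbert \<Rightarrow> ('u \<Rightarrow> 'u) set \<Rightarrow> bool" where
  "unital_cstar_algebra H L \<longleftrightarrow>
     L \<subseteq> bounded_ops H \<and> op_id H \<in> L \<and>
     (\<forall>S\<in>L. \<forall>T\<in>L. op_add H S T \<in> L \<and> op_mult H S T \<in> L) \<and>
     (\<forall>a. \<forall>T\<in>L. op_scale H a T \<in> L) \<and>
     (\<forall>T\<in>L. op_adj H T \<in> L) \<and>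
     closedin (op_topology H) L"

definition invertibles :: "'u hilbert \<Rightarrow> ('u \<Rightarrow> 'u) set \<Rightarrow> ('u \<Rightarrow> 'u) set" where
  "invertibles H L = {S \<in> L. \<exists>T\<in>L. op_mult H S T = op_id H \<and> op_mult H T S = op_id H}"

definition invertibles0 :: "'u hilbert \<Rightarrow> ('u \<Rightarrow> 'u) set \<Rightarrow> ('u \<Rightarrow> 'u) set" where
  "invertibles0 H L =
     connected_component_of_set (subtopology (op_topology H) (invertibles H L)) (op_id H)"

definition normals :: "'u hilbert \<Rightarrow> ('u \<Rightarrow> 'u) set \<Rightarrow> ('u \<Rightarrow> 'u) set" where
  "normals H L = {T \<in> L. op_mult H (op_adj H T) T = op_mult H T (op_adj H T)}"

definition selfadjoints :: "'u hilbert \<Rightarrow> ('u \<Rightarrow> 'u) set \<Rightarrow> ('u \<Rightarrow> 'u) set" where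
  "selfadjoints H L = {T \<in> L. op_adj H T = T}"

definition real_rank_zero :: "'u hilbert \<Rightarrow> ('u \<Rightarrow> 'u) set \<Rightarrow> bool" where
  "real_rank_zero H L \<longleftrightarrow>
     op_topology H closure_of (invertibles H L \<inter> selfadjoints H L) = selfadjoints H L"

definition condition_C :: "'u hilbert \<Rightarrow> ('u \<Rightarrow> 'u) set \<Rightarrow> ('u \<Rightarrow> 'u) \<Rightarrow> bool" where
  "condition_C H L A \<longleftrightarrow>
     (\<forall>z. op_diff H A (op_scale H z (op_id H)) \<in> op_topology H closure_of invertibles0 H L)"

definition op_ball :: "'u hilbert \<Rightarrow> ('u \<Rightarrow> 'u) set \<Rightarrow> real \<Rightarrow> ('u \<Rightarrow> 'u) set" where
  "op_ball H L r = {T \<in> L. op_norm H T \<le> r}"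

definition M_hull :: "'u hilbert \<Rightarrow> ('u \<Rightarrow> 'u) set \<Rightarrow> ('u \<Rightarrow> 'u) \<Rightarrow> ('u \<Rightarrow> 'u) set" where
  "M_hull H L T = op_convex H hull
     {op_mult H (op_mult H S1 T) S2 | S1 S2. S1 \<in> op_ball H L 1 \<and> S2 \<in> op_ball H L 1}"

definition F_of :: "(real \<Rightarrow> real) \<Rightarrow> real \<Rightarrow> real" where
  "F_of h t = (INF \<epsilon>\<in>{0<..}. h \<epsilon> * t + \<epsilon>)"


section \<open>Complex matrices\<close>

definition cadj :: "complex^'n^'n \<Rightarrow> complex^'n^'n" where
  "cadj A = (\<chi> i j. cnj (A $ j $ i))"

definition mat_norm :: "complex^'n^'n \<Rightarrow> real" where
  "mat_norm A = onorm (\<lambda>x. A *v x)"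

definition normal_mats :: "(complex^'n^'n) set" where
  "normal_mats = {T. cadj T ** T = T ** cadj T}"

definition singular_space :: "complex^'n^'n \<Rightarrow> real \<Rightarrow> (complex^'n) set" where
  "singular_space A s = {x. (cadj A ** A) *v x = complex_of_real (s\<^sup>2) *s x}"

definition singular_values :: "complex^'n^'n \<Rightarrow> real set" where
  "singular_values A = {s. 0 \<le> s \<and> (\<exists>x\<in>singular_space A s. x \<noteq> 0)}"

text \<open>The \<open>\<ell>\<^sup>p\<close>-norm of the singular values, each repeated according to its multiplicity.\<close>

definition schatten_norm :: "real \<Rightarrow> complex^'n^'n \<Rightarrow> real" where
  "schatten_norm p A =
     (\<Sum>s\<in>singular_values A. real (vec.dim (singular_space A s)) * s powr p) powr (1 / p)"

end

theory Submission
  imports Defs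
begin

text \<open>
  The hypothesis on \<open>h\<close> speaks of operator algebras on Hilbert spaces, so the idea is to apply it
  to the full matrix algebra and to read off its conclusion in terms of matrices.

  An injection \<open>j\<close> of \<open>\<complex>\<^sup>n\<close> into the universe turns \<open>\<complex>\<^sup>n\<close> into a Hilbert space structure, whose
  bounded operators are exactly the matrices. This algebra has real rank zero and each of its
  elements satisfies condition (C), both for one reason: on the complex line
  \<open>z \<mapsto> A + z (I - A)\<close> the determinant is a nonzero polynomial in \<open>z\<close>, so only finitely many points
  are singular. Hence invertible matrices occur arbitrarily close to \<open>A\<close>
  (and for real \<open>z\<close> they are self-adjoint if \<open>A\<close> is), and an invertible \<open>A\<close> is connected
  to \<open>I\<close> within the line, since the plane minus a finite set is connected.

  The hypothesis now gives \<open>A = T + h(\<epsilon>) X + E\<close> with \<open>T\<close> normal, \<open>\<parallel>T\<parallel> \<le> \<parallel>A\<parallel>\<close>, \<open>\<parallel>E\<parallel> \<le> \<epsilon>\<close> and \<open>X\<close> in the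
  convex hull of the products \<open>S\<^sub>1 C S\<^sub>2\<close>, where \<open>C\<close> is the self-commutator and \<open>S\<^sub>1\<close>, \<open>S\<^sub>2\<close> are
  contractions. Every norm that does not increase under multiplication by contractions satisfies
  \<open>\<parallel>X\<parallel> \<le> \<parallel>C\<parallel>\<close>, which yields the bounds \<open>h(\<epsilon>) \<parallel>C\<parallel> + \<epsilon>\<close> and
  \<open>h(\<epsilon>) \<parallel>C\<parallel>\<^sub>p + n\<^bsup>1/p\<^esup> \<epsilon>\<close> for the distance to the normal matrices; the infimum over \<open>\<epsilon>\<close> is \<open>F\<close>.

  It remains to see that Schatten norms, defined through dimensions of eigenspaces, are norms of
  this kind. This rests on the variational formula
  \<open>\<parallel>A\<parallel>\<^sub>p\<^bsup>p\<^esup> = max (\<Sum>i. \<bar>\<langle>A u\<^sub>i, v\<^sub>i\<rangle>\<bar>\<^bsup>p\<^esup>)\<close> over all families \<open>u\<close>, \<open>v\<close> that satisfy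
  Bessel's inequality. The maximum is attained by the singular vectors
  (\<open>singular_value_decomposition\<close>), and \<open>sum_powr_bessel_le\<close> shows by Jensen's inequality that no
  other pair of families does better, even after multiplication by contractions.
\<close>

section \<open>The Hermitian inner product and the operator norm\<close>

definition cinner :: "complex^'n \<Rightarrow> complex^'n \<Rightarrow> complex" where
  "cinner x y = (\<Sum>i\<in>UNIV. x $ i * cnj (y $ i))"

lemma cinner_add_left: "cinner (x + y) z = cinner x z + cinner y z"
  by (simp add: cinner_def distrib_right sum.distrib)

lemma cinner_scale_left: "cinner (a *s x) y = a * cinner x y"
  by (simp add: cinner_def sum_distrib_left mult.assoc)

lemma cinner_commute: "cinner x y = cnj (cinner y x)"
  by (simp add: cinner_def mult.commute)

lemma cinner_add_right: "cinner x (y + z) = cinner x y + cinner x z"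
  by (simp add: cinner_def distrib_left sum.distrib)

lemma cinner_scale_right: "cinner x (a *s y) = cnj a * cinner x y"
  by (simp add: cinner_def sum_distrib_left mult_ac)

lemma cinner_zero [simp]: "cinner 0 y = 0" "cinner x 0 = 0"
  by (simp_all add: cinner_def)

lemma cinner_diff_left: "cinner (x - y) z = cinner x z - cinner y z"
  by (simp add: cinner_def left_diff_distrib sum_subtractf)

lemma cinner_diff_right: "cinner x (y - z) = cinner x y - cinner x z"
  by (simp add: cinner_def right_diff_distrib sum_subtractf)

lemma cinner_sum_left: "cinner (\<Sum>i\<in>I. f i) y = (\<Sum>i\<in>I. cinner (f i) y)"
  by (induction I rule: infinite_finite_induct) (simp_all add: cinner_add_left)

lemma cinner_sum_right: "cinner y (\<Sum>i\<in>I. f i) = (\<Sum>i\<in>I. cinner y (f i))"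
  by (induction I rule: infinite_finite_induct) (simp_all add: cinner_add_right)

lemma cinner_self: "cinner x x = of_real ((norm x)\<^sup>2)"
  by (simp add: cinner_def norm_vec_def L2_set_def sum_nonneg complex_norm_square
      flip: of_real_power)

lemma cmod_cinner_self: "cmod (cinner x x) = (norm x)\<^sup>2"
  unfolding cinner_self norm_of_real by simp

lemma Re_cinner: "Re (cinner x y) = inner x y"
  by (simp add: cinner_def inner_vec_def inner_complex_def)

lemma cinner_self_eq_0: "cinner x x = 0 \<longleftrightarrow> x = 0"
  by (simp add: cinner_self)

lemma norm_vector_scale: "norm (a *s x :: complex^'n) = cmod a * norm x"
  by (simp add: norm_vec_def norm_mult L2_set_right_distrib)

lemma cmod_cinner_le: "cmod (cinner x y) \<le> norm x * norm y"
proof -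
  have "cmod (cinner x y) \<le> (\<Sum>i\<in>UNIV. cmod (x $ i * cnj (y $ i)))"
    unfolding cinner_def by (rule norm_sum)
  also have "\<dots> = (\<Sum>i\<in>UNIV. \<bar>cmod (x $ i)\<bar> * \<bar>cmod (y $ i)\<bar>)"
    by (simp add: norm_mult)
  also have "\<dots> \<le> norm x * norm y"
    unfolding norm_vec_def by (rule L2_set_mult_ineq)
  finally show ?thesis .
qed

lemma cinner_adj: "cinner (A *v x) y = cinner x (cadj A *v y)"
proof -
  have "cinner (A *v x) y = (\<Sum>i\<in>UNIV. \<Sum>j\<in>UNIV. A $ i $ j * x $ j * cnj (y $ i))"
    by (simp add: cinner_def matrix_vector_mult_def sum_distrib_right)
  also have "\<dots> = (\<Sum>j\<in>UNIV. \<Sum>i\<in>UNIV. A $ i $ j * x $ j * cnj (y $ i))"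
    by (rule sum.swap)
  also have "\<dots> = cinner x (cadj A *v y)"
    by (simp add: cinner_def matrix_vector_mult_def cadj_def sum_distrib_left mult_ac)
  finally show ?thesis .
qed

lemma cadj_cadj [simp]: "cadj (cadj A) = A"
  by (simp add: cadj_def vec_eq_iff)

lemma cadj_diff: "cadj (A - B) = cadj A - cadj B"
  by (simp add: cadj_def vec_eq_iff)

lemma cadj_add: "cadj (A + B) = cadj A + cadj B"
  by (simp add: cadj_def vec_eq_iff)

lemma cadj_mat: "cadj (mat a) = mat (cnj a)"
  by (simp add: cadj_def vec_eq_iff mat_def)

lemma cadj_mult: "cadj (A ** B) = cadj B ** cadj A"
  by (simp add: cadj_def vec_eq_iff matrix_matrix_mult_def mult.commute)

lemma matrix_vector_scale: "A *v (a *s x) = a *s (A *v x :: complex^'n)"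
  by (simp add: vec_eq_iff matrix_vector_mult_def sum_distrib_left mult_ac)

lemma matrix_vector_scaleR: "A *v (r *\<^sub>R x) = r *\<^sub>R (A *v x :: complex^'n)"
  by (simp add: vec_eq_iff matrix_vector_mult_def scaleR_sum_right)

lemma mat_vector_mult: "mat a *v x = a *s (x :: complex^'n)"
  by (simp add: vec_eq_iff matrix_vector_mult_def mat_def if_distrib[of "\<lambda>c. c * _"] cong del: if_weak_cong)

lemma mat_of_real_mult: "mat (complex_of_real r) ** A = r *\<^sub>R A"
  by (simp add: vec_eq_iff matrix_matrix_mult_def mat_def if_distrib[of "\<lambda>c. c * _"]
      scaleR_conv_of_real[where 'a = complex] cong del: if_weak_cong)

lemma matrix_vector_sum: "A *v (\<Sum>i\<in>I. f i) = (\<Sum>i\<in>I. A *v f i :: complex^'n)"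
  by (induction I rule: infinite_finite_induct) (simp_all add: matrix_vector_right_distrib)

lemma cinner_eqI: "(\<And>y. cinner y x = cinner y x') \<Longrightarrow> x = x'"
  using cinner_self_eq_0[of "x - x'"] by (simp add: cinner_diff_right)

lemma norm_matrix_vector_le: "norm (A *v x) \<le> mat_norm A * norm x"
  unfolding mat_norm_def by (rule onorm) simp

lemma mat_norm_nonneg: "0 \<le> mat_norm A"
  unfolding mat_norm_def by (rule onorm_pos_le) simp

lemma mat_norm_least:
  assumes "\<And>x. norm (A *v x) \<le> b * norm x"
  shows "mat_norm A \<le> b"
  unfolding mat_norm_def by (rule onorm_le) (rule assms)

lemma mat_norm_triangle: "mat_norm (A + B) \<le> mat_norm A + mat_norm B"
proof (rule mat_norm_least)
  fix x
  show "norm ((A + B) *v x) \<le> (mat_norm A + mat_norm B) * norm x"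
    using norm_triangle_ineq[of "A *v x" "B *v x"] norm_matrix_vector_le[of A x]
      norm_matrix_vector_le[of B x]
    by (simp add: matrix_vector_mult_add_rdistrib distrib_right)
qed

lemma mat_norm_mult: "mat_norm (A ** B) \<le> mat_norm A * mat_norm B"
proof (rule mat_norm_least)
  fix x
  have "norm (A *v (B *v x)) \<le> mat_norm A * norm (B *v x)"
    by (rule norm_matrix_vector_le)
  also have "\<dots> \<le> mat_norm A * (mat_norm B * norm x)"
    by (intro mult_left_mono norm_matrix_vector_le mat_norm_nonneg)
  finally show "norm ((A ** B) *v x) \<le> mat_norm A * mat_norm B * norm x"
    by (simp add: matrix_vector_mul_assoc mult.assoc)
qed

lemma mat_norm_scaleR: "mat_norm (r *\<^sub>R A) = \<bar>r\<bar> * mat_norm A"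
proof -
  have "(\<lambda>x. (r *\<^sub>R A) *v x) = (\<lambda>x. r *\<^sub>R (A *v x))"
    by (auto simp: vec_eq_iff matrix_vector_mult_def scaleR_sum_right)
  then show ?thesis
    unfolding mat_norm_def by (simp add: onorm_scaleR)
qed

lemma mat_norm_mat_1: "mat_norm (mat 1 :: complex^'n^'n) \<le> 1"
  by (rule mat_norm_least) simp

lemma mat_norm_minus_commute: "mat_norm (A - B) = mat_norm (B - A)"
  using mat_norm_scaleR[of "-1" "A - B"] by simp

text \<open>For \<open>y = A\<^sup>*x\<close> one has \<open>\<parallel>y\<parallel>\<^sup>2 = \<langle>A y, x\<rangle> \<le> \<parallel>A\<parallel> \<parallel>y\<parallel> \<parallel>x\<parallel>\<close>.\<close>

lemma mat_norm_cadj_le: "mat_norm (cadj A) \<le> mat_norm A"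
proof (rule mat_norm_least)
  fix x
  let ?y = "cadj A *v x"
  have "(norm ?y)\<^sup>2 = cmod (cinner (A *v ?y) x)"
    by (simp add: cinner_adj cinner_self norm_power)
  also have "\<dots> \<le> norm (A *v ?y) * norm x"
    by (rule cmod_cinner_le)
  also have "\<dots> \<le> mat_norm A * norm ?y * norm x"
    by (intro mult_right_mono norm_matrix_vector_le norm_ge_zero)
  finally have "norm ?y * norm ?y \<le> norm ?y * (mat_norm A * norm x)"
    by (simp add: power2_eq_square mult_ac)
  then show "norm ?y \<le> mat_norm A * norm x"
    by (cases "norm ?y = 0") (simp_all add: mat_norm_nonneg)
qed

lemma mat_norm_cadj: "mat_norm (cadj A) = mat_norm A"
  using mat_norm_cadj_le[of A] mat_norm_cadj_le[of "cadj A"] by simp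

section \<open>Bessel families and the singular value decomposition\<close>

text \<open>
  Bessel families are used instead of orthonormal bases because they may contain zero vectors: left
  singular vectors that belong to the singular value 0 can then be taken to be 0, and need
  not be completed to a basis.
\<close>

definition bessel :: "('n \<Rightarrow> complex^'n) \<Rightarrow> bool" where
  "bessel u \<longleftrightarrow> (\<forall>x. (\<Sum>i\<in>UNIV. (cmod (cinner x (u i)))\<^sup>2) \<le> (norm x)\<^sup>2)"

lemma besselD: "bessel u \<Longrightarrow> (\<Sum>i\<in>UNIV. (cmod (cinner x (u i)))\<^sup>2) \<le> (norm x)\<^sup>2"
  by (simp add: bessel_def)

text \<open>Bessel's inequality for \<open>u\<^sub>i\<close> itself gives \<open>\<parallel>u\<^sub>i\<parallel>\<^sup>4 \<le> \<parallel>u\<^sub>i\<parallel>\<^sup>2\<close>.\<close>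

lemma bessel_norm_le_1:
  assumes "bessel u"
  shows "norm (u i) \<le> 1"
proof (rule ccontr)
  assume gt: "\<not> norm (u i) \<le> 1"
  have "(cmod (cinner (u i) (u i)))\<^sup>2 \<le> (\<Sum>k\<in>UNIV. (cmod (cinner (u i) (u k)))\<^sup>2)"
    by (rule member_le_sum) simp_all
  also have "\<dots> \<le> (norm (u i))\<^sup>2"
    using assms by (rule besselD)
  finally have "(norm (u i))\<^sup>2 * (norm (u i))\<^sup>2 \<le> (norm (u i))\<^sup>2 * 1"
    unfolding cmod_cinner_self by (simp add: power2_eq_square)
  moreover have "1 < (norm (u i))\<^sup>2"
    using gt by (simp add: one_less_power)
  ultimately show False
    using mult_strict_left_mono[of 1 "(norm (u i))\<^sup>2" "(norm (u i))\<^sup>2"] by linarith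
qed

text \<open>
  With \<open>z = \<Sum>i. \<langle>x, u\<^sub>i\<rangle> u\<^sub>i\<close>, the sum in Bessel's inequality equals both \<open>\<langle>x, z\<rangle>\<close> and \<open>\<parallel>z\<parallel>\<^sup>2\<close>, so the
  Cauchy-Schwarz inequality gives \<open>\<parallel>z\<parallel> \<le> \<parallel>x\<parallel>\<close>.
\<close>

lemma bessel_orthonormal:
  assumes orth: "\<And>i k. i \<noteq> k \<Longrightarrow> cinner (u i) (u k) = 0"
    and unit: "\<And>i. u i = 0 \<or> norm (u i) = 1"
  shows "bessel u"
  unfolding bessel_def
proof
  fix x
  define c where "c i = cinner x (u i)" for i
  define z where "z = (\<Sum>i\<in>UNIV. c i *s u i)"
  define S where "S = (\<Sum>i\<in>UNIV. (cmod (c i))\<^sup>2)"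
  have S0: "0 \<le> S"
    unfolding S_def by (intro sum_nonneg) simp
  have xz: "cinner x z = of_real S"
    by (simp add: z_def S_def cinner_sum_right cinner_scale_right complex_norm_square mult.commute
        flip: c_def of_real_power)
  have "cinner z (u k) = c k" for k
  proof -
    have "cinner z (u k) = (\<Sum>i\<in>UNIV. c i * cinner (u i) (u k))"
      by (simp add: z_def cinner_sum_left cinner_scale_left)
    also have "\<dots> = (\<Sum>i\<in>UNIV. if i = k then c k * cinner (u k) (u k) else 0)"
      by (intro sum.cong refl) (auto simp: orth)
    also have "\<dots> = c k * cinner (u k) (u k)"
      by simp
    finally show ?thesis
      using unit[of k] by (auto simp: cinner_self c_def)
  qed
  then have "cinner z z = of_real S"
    unfolding S_def by (subst (2) z_def)
      (simp add: cinner_sum_right cinner_scale_right complex_norm_square mult.commute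
        flip: of_real_power)
  then have "of_real ((norm z)\<^sup>2) = (of_real S :: complex)"
    by (simp only: cinner_self)
  then have zz: "(norm z)\<^sup>2 = S"
    by (simp only: of_real_eq_iff)
  have "S = cmod (cinner x z)"
    using S0 by (simp add: xz)
  also have "\<dots> \<le> norm x * norm z"
    by (rule cmod_cinner_le)
  finally have "norm z * norm z \<le> norm x * norm z"
    by (simp add: zz[symmetric] power2_eq_square)
  then have "norm z \<le> norm x"
    by (cases "z = 0") simp_all
  then have "S \<le> (norm x)\<^sup>2"
    unfolding zz[symmetric] by (intro power_mono) simp_all
  then show "(\<Sum>i\<in>UNIV. (cmod (cinner x (u i)))\<^sup>2) \<le> (norm x)\<^sup>2"
    by (simp add: S_def c_def)
qed

lemma norm_add_scaled:
  "(norm (x + t *\<^sub>R z))\<^sup>2 = (norm x)\<^sup>2 + 2 * t * inner x z + t\<^sup>2 * (norm z)\<^sup>2"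
  unfolding power2_norm_eq_inner inner_add_left inner_add_right
  by (simp only: inner_scaleR_left inner_scaleR_right inner_commute[of z x] power2_eq_square algebra_simps)

text \<open>
  The induction step of the spectral theorem for \<open>A\<^sup>*A\<close>. The orthogonal complement \<open>W\<close> of
  the eigenvectors found so far is invariant under \<open>A\<^sup>*A\<close> and nonzero for dimension reasons. Let \<open>x\<close>
  maximize \<open>\<parallel>A x\<parallel>\<close> on its unit sphere, with maximum \<open>r\<close>. The form \<open>r\<^sup>2 \<parallel>y\<parallel>\<^sup>2 - \<parallel>A y\<parallel>\<^sup>2\<close> is nonnegative
  on \<open>W\<close> and vanishes at \<open>x\<close>, so its derivative at \<open>x\<close> vanishes along \<open>W\<close>. In the direction of
  \<open>z = r\<^sup>2 x - A\<^sup>*A x\<close> this derivative is \<open>2 \<parallel>z\<parallel>\<^sup>2\<close>.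
\<close>

lemma next_singular_vector:
  fixes A :: "complex^'n^'n" and u :: "'n \<Rightarrow> complex^'n"
  assumes J: "J \<noteq> UNIV"
    and eig: "\<And>i. i \<in> J \<Longrightarrow> (cadj A ** A) *v u i = complex_of_real ((s i)\<^sup>2) *s u i"
    and unit: "\<And>i. i \<in> J \<Longrightarrow> norm (u i) = 1"
    and orth: "\<And>i k. \<lbrakk>i \<in> J; k \<in> J; i \<noteq> k\<rbrakk> \<Longrightarrow> cinner (u i) (u k) = 0"
  obtains x r where "norm x = 1" "0 \<le> r" "\<And>i. i \<in> J \<Longrightarrow> cinner x (u i) = 0"
    "(cadj A ** A) *v x = complex_of_real (r\<^sup>2) *s x"
proof -
  define W where "W = {x. \<forall>i\<in>J. cinner x (u i) = 0}"
  have W_add: "x + y \<in> W" if "x \<in> W" "y \<in> W" for x y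
    using that by (simp add: W_def cinner_add_left)
  have W_scale: "a *s x \<in> W" if "x \<in> W" for a x
    using that by (simp add: W_def cinner_scale_left)
  have W_scaleR: "a *\<^sub>R x \<in> W" if "x \<in> W" for a :: real and x
    using W_scale[OF that, of "of_real a"]
    by (simp add: vector_scalar_mult_def scaleR_vec_def scaleR_conv_of_real[where 'a = complex])
  have adj_A: "cinner ((cadj A ** A) *v y) x = cinner y ((cadj A ** A) *v x)" for x y
    by (simp add: cinner_adj cadj_mult)
  have W_op: "(cadj A ** A) *v x \<in> W" if "x \<in> W" for x
    using that eig by (simp add: W_def adj_A cinner_scale_right)
  have "\<exists>y. y \<notin> vec.span (u ` J)"
  proof (rule ccontr)
    assume "\<not> ?thesis"
    then have "CARD('n) \<le> card (u ` J)"
      using vec.dim_le_card[of UNIV "u ` J"] vec_dim_card[where 'a = complex and 'n = 'n] by auto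
    also have "\<dots> \<le> card J"
      by (rule card_image_le) simp
    also have "\<dots> < CARD('n)"
      using J by (intro psubset_card_mono) auto
    finally show False
      by simp
  qed
  then obtain y where y: "y \<notin> vec.span (u ` J)" ..
  define y' where "y' = y - (\<Sum>i\<in>J. cinner y (u i) *s u i)"
  have "(\<Sum>i\<in>J. cinner y (u i) *s u i) \<in> vec.span (u ` J)"
    by (intro vec.span_sum vec.span_scale vec.span_base) auto
  with y have "y' \<noteq> 0"
    by (auto simp: y'_def)
  moreover have "y' \<in> W"
  proof -
    have "cinner (\<Sum>i\<in>J. cinner y (u i) *s u i) (u k) = cinner y (u k)" if k: "k \<in> J" for k
    proof -
      have "cinner (\<Sum>i\<in>J. cinner y (u i) *s u i) (u k)
          = (\<Sum>i\<in>J. cinner y (u i) * cinner (u i) (u k))"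
        by (simp add: cinner_sum_left cinner_scale_left)
      also have "\<dots> = (\<Sum>i\<in>J. if i = k then cinner y (u k) * cinner (u k) (u k) else 0)"
        using k by (intro sum.cong refl) (auto simp: orth)
      also have "\<dots> = cinner y (u k)"
        using k by (simp add: cinner_self unit)
      finally show ?thesis .
    qed
    then show ?thesis
      by (simp add: W_def y'_def cinner_diff_left)
  qed
  ultimately have "inverse (norm y') *\<^sub>R y' \<in> W \<inter> sphere 0 1"
    by (simp add: W_scaleR)
  then have nonempty: "W \<inter> sphere 0 1 \<noteq> {}"
    by blast
  have "W = (\<Inter>i\<in>J. {x. cinner x (u i) = 0})"
    by (auto simp: W_def)
  then have "closed W"
    by (auto simp: cinner_def intro!: closed_INT closed_Collect_eq continuous_intros)
  then have "compact (W \<inter> sphere 0 1)"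
    by (rule closed_Int_compact) simp
  moreover have "continuous_on (W \<inter> sphere 0 1) (\<lambda>x. norm (A *v x))"
    by (intro continuous_intros linear_continuous_on) simp
  ultimately have "\<exists>x\<in>W \<inter> sphere 0 1. \<forall>y\<in>W \<inter> sphere 0 1. norm (A *v y) \<le> norm (A *v x)"
    using nonempty by (intro continuous_attains_sup)
  then obtain x where x: "x \<in> W" "norm x = 1"
    and max: "\<And>y. \<lbrakk>y \<in> W; norm y = 1\<rbrakk> \<Longrightarrow> norm (A *v y) \<le> norm (A *v x)"
    by (metis Int_iff mem_sphere_0)
  define r where "r = norm (A *v x)"
  have bound: "norm (A *v y) \<le> r * norm y" if "y \<in> W" for y
  proof (cases "y = 0")
    case False
    then have "norm (A *v (inverse (norm y) *\<^sub>R y)) \<le> r"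
      unfolding r_def using that by (intro max W_scaleR) simp_all
    moreover have "A *v (inverse (norm y) *\<^sub>R y) = inverse (norm y) *\<^sub>R (A *v y)"
      by (rule matrix_vector_scaleR)
    ultimately show ?thesis
      using False by (simp add: field_simps)
  qed simp
  define z where "z = (r\<^sup>2) *\<^sub>R x - (cadj A ** A) *v x"
  have zW: "z \<in> W"
    using W_add[OF W_scaleR[OF x(1), of "r\<^sup>2"] W_scaleR[OF W_op[OF x(1)], of "-1"]]
    by (simp add: z_def)
  have inner_op: "inner ((cadj A ** A) *v x) y = inner (A *v x) (A *v y)" for y
    using arg_cong[where f = Re, OF cinner_adj[of "cadj A" "A *v x" y]]
    by (simp add: matrix_vector_mul_assoc Re_cinner)
  define a where "a = (norm z)\<^sup>2"
  define b where "b = r\<^sup>2 * (norm z)\<^sup>2 - (norm (A *v z))\<^sup>2"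
  have quad: "0 \<le> t * (2 * a) + t\<^sup>2 * b" for t
  proof -
    have a_inner: "a = r\<^sup>2 * inner x z - inner (A *v x) (A *v z)"
      unfolding a_def power2_norm_eq_inner
      by (subst (1) z_def) (simp add: inner_diff_left inner_op)
    have "(norm (A *v (x + t *\<^sub>R z)))\<^sup>2 \<le> (r * norm (x + t *\<^sub>R z))\<^sup>2"
      by (intro power_mono bound W_add W_scaleR x zW) simp
    moreover have "(norm (A *v (x + t *\<^sub>R z)))\<^sup>2
        = r\<^sup>2 + 2 * t * inner (A *v x) (A *v z) + t\<^sup>2 * (norm (A *v z))\<^sup>2"
      by (simp add: r_def matrix_vector_right_distrib matrix_vector_scaleR norm_add_scaled)
    moreover have "(norm (x + t *\<^sub>R z))\<^sup>2 = 1 + 2 * t * inner x z + t\<^sup>2 * (norm z)\<^sup>2"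
      using x(2) by (simp add: norm_add_scaled)
    moreover have "t * (2 * a) = 2 * t * (r\<^sup>2 * inner x z) - 2 * t * inner (A *v x) (A *v z)"
      unfolding a_inner by (simp only: algebra_simps)
    ultimately show ?thesis
      by (simp add: power_mult_distrib b_def algebra_simps)
  qed
  have "a = 0"
  proof (rule ccontr)
    assume "a \<noteq> 0"
    then have a: "0 < a"
      by (simp add: a_def)
    \<comment> \<open>A negative \<open>t\<close> so small that the linear term of \<open>2 a t + b t\<^sup>2\<close> dominates.\<close>
    define t where "t = - a / (\<bar>b\<bar> + 1)"
    have t: "t < 0"
      using a by (simp add: t_def divide_neg_pos)
    have "t * b \<ge> - a"
    proof -
      have "\<bar>t * b\<bar> = a * (\<bar>b\<bar> / (\<bar>b\<bar> + 1))"
        using a by (simp add: t_def abs_mult)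
      also have "\<dots> \<le> a * 1"
        using a by (intro mult_left_mono) simp_all
      finally show ?thesis
        by linarith
    qed
    then have "t * (2 * a + t * b) < 0"
      using a t by (intro mult_neg_pos) linarith+
    then show False
      using quad[of t] by (simp add: power2_eq_square algebra_simps)
  qed
  then have "(cadj A ** A) *v x = (r\<^sup>2) *\<^sub>R x"
    by (simp add: a_def z_def)
  also have "\<dots> = complex_of_real (r\<^sup>2) *s x"
    by (simp add: vector_scalar_mult_def scaleR_vec_def scaleR_conv_of_real[where 'a = complex])
  finally show ?thesis
    using that[of x r] x by (simp add: r_def W_def)
qed

lemma orthonormal_singular_vectors:
  fixes A :: "complex^'n^'n"
  obtains u :: "'n \<Rightarrow> complex^'n" and s :: "'n \<Rightarrow> real"
  where "\<And>i. 0 \<le> s i" "\<And>i. (cadj A ** A) *v u i = complex_of_real ((s i)\<^sup>2) *s u i"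
    "\<And>i. norm (u i) = 1" "\<And>i k. i \<noteq> k \<Longrightarrow> cinner (u i) (u k) = 0"
proof -
  have "\<exists>(u :: 'n \<Rightarrow> complex^'n) s. \<forall>i\<in>J. 0 \<le> s i \<and> norm (u i) = 1
      \<and> (cadj A ** A) *v u i = complex_of_real ((s i)\<^sup>2) *s u i
      \<and> (\<forall>k\<in>J. i \<noteq> k \<longrightarrow> cinner (u i) (u k) = 0)" for J :: "'n set"
    using finite[of J]
  proof (induction J rule: finite_induct)
    case (insert j J)
    then obtain u s where us: "\<forall>i\<in>J. 0 \<le> s i \<and> norm (u i :: complex^'n) = 1
      \<and> (cadj A ** A) *v u i = complex_of_real ((s i)\<^sup>2) *s u i
      \<and> (\<forall>k\<in>J. i \<noteq> k \<longrightarrow> cinner (u i) (u k) = 0)"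
      by blast
    have "J \<noteq> UNIV"
      using insert.hyps by blast
    then obtain x r where x: "norm x = 1" "0 \<le> r" "\<And>i. i \<in> J \<Longrightarrow> cinner x (u i) = 0"
      "(cadj A ** A) *v x = complex_of_real (r\<^sup>2) *s x"
      using next_singular_vector[of J A u s] us by blast
    have "cinner (u i) x = 0" if "i \<in> J" for i
      using x(3)[OF that] cinner_commute[of "u i" x] by simp
    then show ?case
      using us x insert.hyps by (intro exI[of _ "u(j := x)"] exI[of _ "s(j := r)"]) auto
  qed auto
  from this[of UNIV] show ?thesis
    using that by blast
qed

text \<open>
  The matrix \<open>U\<close> with columns \<open>u\<^sub>i\<close> satisfies \<open>U\<^sup>*U = I\<close>, and a left inverse of a square matrix is
  also a right inverse; \<open>x = U (U\<^sup>*x)\<close> is the claim.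
\<close>

lemma orthonormal_expansion:
  fixes u :: "'n \<Rightarrow> complex^'n"
  assumes unit: "\<And>i. norm (u i) = 1"
    and orth: "\<And>i k. i \<noteq> k \<Longrightarrow> cinner (u i) (u k) = 0"
  shows "x = (\<Sum>i\<in>UNIV. cinner x (u i) *s u i)"
proof -
  define U :: "complex^'n^'n" where "U = (\<chi> r c. u c $ r)"
  have "(cadj U ** U) $ i $ k = cinner (u k) (u i)" for i k
    by (simp add: matrix_matrix_mult_def cadj_def U_def cinner_def mult.commute)
  then have "cadj U ** U = mat 1"
    by (auto simp: vec_eq_iff mat_def cinner_self unit orth)
  then have "U ** cadj U = mat 1"
    by (simp add: matrix_left_right_inverse)
  then have "x = U *v (cadj U *v x)"
    by (simp add: matrix_vector_mul_assoc)
  also have "cadj U *v x = (\<chi> i. cinner x (u i))"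
    by (simp add: vec_eq_iff matrix_vector_mult_def cadj_def U_def cinner_def mult.commute)
  also have "U *v \<dots> = (\<Sum>i\<in>UNIV. cinner x (u i) *s u i)"
    by (simp add: vec_eq_iff matrix_vector_mult_def U_def mult.commute)
  finally show ?thesis .
qed

text \<open>
  This turns the sum over distinct singular values, weighted by the dimensions of their
  eigenspaces, into a sum over an orthonormal basis of eigenvectors: those basis vectors that belong
  to a given singular value form a basis of its eigenspace, because eigenvectors to different
  eigenvalues are orthogonal.
\<close>

lemma schatten_sum_orthonormal:
  fixes A :: "complex^'n^'n"
  assumes s: "\<And>i. 0 \<le> s i"
    and eig: "\<And>i. (cadj A ** A) *v u i = complex_of_real ((s i)\<^sup>2) *s u i"
    and unit: "\<And>i. norm (u i) = 1"
    and orth: "\<And>i k. i \<noteq> k \<Longrightarrow> cinner (u i) (u k) = 0"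
  shows "(\<Sum>\<sigma>\<in>singular_values A. real (vec.dim (singular_space A \<sigma>)) * f \<sigma>)
    = (\<Sum>i\<in>(UNIV :: 'n set). f (s i))"
proof -
  have expand: "x = (\<Sum>i\<in>UNIV. cinner x (u i) *s u i)" for x
    by (rule orthonormal_expansion[OF unit orth])
  have coeff: "cinner x (u i) = 0" if x: "x \<in> singular_space A \<sigma>" and "s i \<noteq> \<sigma>" "0 \<le> \<sigma>" for x \<sigma> i
  proof -
    have "complex_of_real (\<sigma>\<^sup>2) * cinner x (u i) = cinner ((cadj A ** A) *v x) (u i)"
      using x by (simp add: singular_space_def cinner_scale_left)
    also have "\<dots> = cinner x ((cadj A ** A) *v u i)"
      by (simp add: cinner_adj cadj_mult)
    also have "\<dots> = complex_of_real ((s i)\<^sup>2) * cinner x (u i)"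
      by (simp only: eig cinner_scale_right complex_cnj_complex_of_real)
    finally have "\<sigma>\<^sup>2 = (s i)\<^sup>2 \<or> cinner x (u i) = 0"
      by (auto simp only: mult_cancel_right of_real_eq_iff)
    then show ?thesis
      using that(2,3) s[of i] by auto
  qed
  have mem: "u i \<in> singular_space A (s i)" for i
    by (simp only: singular_space_def eig mem_Collect_eq)
  have inj: "inj u"
  proof (rule injI, rule ccontr)
    fix i k assume "u i = u k" "i \<noteq> k"
    then show False
      using orth[of i k] unit[of k] by (simp add: cinner_self)
  qed
  have span: "vec.span (range u) = UNIV"
  proof -
    have "x \<in> vec.span (range u)" for x
      by (subst expand[of x]) (intro vec.span_sum vec.span_scale vec.span_base, auto)
    then show ?thesis
      by auto
  qed
  have indep: "vec.independent (range u)"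
    using span inj vec_dim_card[where 'a = complex and 'n = 'n]
    by (intro vec.card_le_dim_spanning[of _ UNIV]) (auto simp: card_image)
  have dim: "vec.dim (singular_space A \<sigma>) = card {i. s i = \<sigma>}" if "0 \<le> \<sigma>" for \<sigma>
  proof -
    have "singular_space A \<sigma> \<subseteq> vec.span (u ` {i. s i = \<sigma>})"
    proof
      fix x assume x: "x \<in> singular_space A \<sigma>"
      have "x = (\<Sum>i\<in>{i. s i = \<sigma>}. cinner x (u i) *s u i)"
        by (subst expand[of x], rule sum.mono_neutral_right)
          (use coeff[OF x _ that] in auto)
      also have "\<dots> \<in> vec.span (u ` {i. s i = \<sigma>})"
        by (intro vec.span_sum vec.span_scale vec.span_base) auto
      finally show "x \<in> vec.span (u ` {i. s i = \<sigma>})" .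
    qed
    moreover have "u ` {i. s i = \<sigma>} \<subseteq> singular_space A \<sigma>"
      using mem by auto
    moreover have "vec.independent (u ` {i. s i = \<sigma>})"
      using indep by (rule vec.independent_mono) auto
    moreover have "card (u ` {i. s i = \<sigma>}) = card {i. s i = \<sigma>}"
      by (rule card_image) (rule inj_on_subset[OF inj], simp)
    ultimately show ?thesis
      by (intro vec.dim_unique)
  qed
  have "singular_values A = range s"
  proof
    show "range s \<subseteq> singular_values A"
    proof
      fix \<sigma> assume "\<sigma> \<in> range s"
      then obtain i where i: "\<sigma> = s i"
        by blast
      have "u i \<noteq> 0"
        using unit[of i] by auto
      then show "\<sigma> \<in> singular_values A"
        unfolding singular_values_def i using s mem by blast
    qed
    show "singular_values A \<subseteq> range s"
    proof
      fix \<sigma> assume "\<sigma> \<in> singular_values A"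
      then obtain x where \<sigma>: "0 \<le> \<sigma>" and x: "x \<in> singular_space A \<sigma>" "x \<noteq> 0"
        by (auto simp: singular_values_def)
      show "\<sigma> \<in> range s"
      proof (rule ccontr)
        assume "\<sigma> \<notin> range s"
        then have "cinner x (u i) = 0" for i
          using coeff[OF x(1) _ \<sigma>, of i] by blast
        then show False
          using expand[of x] x(2) by simp
      qed
    qed
  qed
  then have "(\<Sum>\<sigma>\<in>singular_values A. real (vec.dim (singular_space A \<sigma>)) * f \<sigma>)
      = (\<Sum>\<sigma>\<in>range s. real (card {i. s i = \<sigma>}) * f \<sigma>)"
    by (auto intro!: sum.cong simp: dim s)
  also have "\<dots> = (\<Sum>\<sigma>\<in>range s. \<Sum>i\<in>{i \<in> UNIV. s i = \<sigma>}. f (s i))"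
    by (intro sum.cong refl) simp
  also have "\<dots> = (\<Sum>i\<in>UNIV. f (s i))"
    by (intro sum.group) auto
  finally show ?thesis .
qed

text \<open>
  The vectors \<open>A u\<^sub>i\<close> are orthogonal and have norm \<open>s\<^sub>i\<close>. Normalized, they are the left singular
  vectors \<open>v\<^sub>i\<close>; for \<open>s\<^sub>i = 0\<close>, division by zero gives \<open>v\<^sub>i = 0\<close>, as Bessel families allow.
\<close>

lemma singular_value_decomposition:
  fixes A :: "complex^'n^'n"
  obtains u v :: "'n \<Rightarrow> complex^'n" and s :: "'n \<Rightarrow> real"
  where "bessel u" "bessel v" "\<And>i. 0 \<le> s i"
    "\<And>x. A *v x = (\<Sum>k\<in>UNIV. (complex_of_real (s k) * cinner x (u k)) *s v k)"
    "\<And>i. cinner (A *v u i) (v i) = complex_of_real (s i)"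
    "\<And>p. schatten_norm p A = (\<Sum>i\<in>UNIV. s i powr p) powr (1 / p)"
proof -
  obtain u :: "'n \<Rightarrow> complex^'n" and s where s: "\<And>i. 0 \<le> s i"
    and eig: "\<And>i. (cadj A ** A) *v u i = complex_of_real ((s i)\<^sup>2) *s u i"
    and unit: "\<And>i. norm (u i) = 1"
    and orth: "\<And>i k. i \<noteq> k \<Longrightarrow> cinner (u i) (u k) = 0"
    using orthonormal_singular_vectors[of A] by metis
  define v where "v i = (1 / complex_of_real (s i)) *s (A *v u i)" for i
  have AA: "cinner (A *v u i) (A *v u k) = complex_of_real ((s k)\<^sup>2) * cinner (u i) (u k)" for i k
  proof -
    have "cinner (A *v u i) (A *v u k) = cinner (u i) ((cadj A ** A) *v u k)"
      by (simp only: cinner_adj matrix_vector_mul_assoc)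
    then show ?thesis
      by (simp only: eig cinner_scale_right complex_cnj_complex_of_real)
  qed
  have normA: "norm (A *v u i) = s i" for i
  proof -
    have "complex_of_real ((norm (A *v u i))\<^sup>2) = complex_of_real ((s i)\<^sup>2 * (norm (u i))\<^sup>2)"
      by (simp only: cinner_self[symmetric] AA of_real_mult)
    then have "(norm (A *v u i))\<^sup>2 = (s i)\<^sup>2"
      unfolding of_real_eq_iff by (simp add: unit)
    then show ?thesis
      using s by simp
  qed
  have Au: "A *v u i = complex_of_real (s i) *s v i" for i
    using normA[of i] by (cases "s i = 0") (simp_all add: v_def vector_smult_assoc)
  have "bessel v"
  proof (rule bessel_orthonormal)
    show "cinner (v i) (v k) = 0" if "i \<noteq> k" for i k
      using that by (simp add: v_def cinner_scale_left cinner_scale_right AA orth)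
    show "v i = 0 \<or> norm (v i) = 1" for i
      using s[of i] by (cases "s i = 0") (simp_all add: v_def norm_vector_scale norm_divide normA)
  qed
  moreover have "bessel u"
    by (rule bessel_orthonormal) (simp_all add: unit orth)
  moreover have "A *v x = (\<Sum>k\<in>UNIV. (complex_of_real (s k) * cinner x (u k)) *s v k)" for x
  proof -
    have "A *v x = A *v (\<Sum>k\<in>UNIV. cinner x (u k) *s u k)"
      using orthonormal_expansion[where u = u and x = x, OF unit orth] by simp
    also have "\<dots> = (\<Sum>k\<in>UNIV. cinner x (u k) *s (A *v u k))"
      by (simp only: matrix_vector_sum matrix_vector_scale)
    also have "\<dots> = (\<Sum>k\<in>UNIV. (complex_of_real (s k) * cinner x (u k)) *s v k)"
      by (simp only: Au vector_smult_assoc mult.commute)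
    finally show ?thesis .
  qed
  moreover have "cinner (A *v u i) (v i) = complex_of_real (s i)" for i
    using AA[of i i] by (cases "s i = 0")
      (simp_all add: v_def cinner_scale_right cinner_self unit power2_eq_square)
  moreover have "schatten_norm p A = (\<Sum>i\<in>UNIV. s i powr p) powr (1 / p)" for p
    unfolding schatten_norm_def by (subst schatten_sum_orthonormal[OF s eig unit orth]) simp_all
  ultimately show ?thesis
    using that s by blast
qed

section \<open>Convexity inequalities for powers\<close>

text \<open>The graph of \<open>x \<mapsto> x\<^bsup>p\<^esup>\<close> lies above its tangents, also at the boundary point \<open>x = 0\<close>.\<close>

lemma powr_tangent:
  fixes a x p :: real
  assumes "1 \<le> p" "0 < a" "0 \<le> x"
  shows "a powr p + p * a powr (p - 1) * (x - a) \<le> x powr p"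
proof (cases "x = 0")
  case True
  have "p * a powr (p - 1) * a = p * a powr p"
    using assms(2) by (simp add: powr_diff)
  moreover have "0 \<le> (p - 1) * a powr p"
    using assms by simp
  ultimately show ?thesis
    using assms True by (simp add: algebra_simps)
next
  case False
  have "(p * a powr (p - 1)) * (x - a) \<le> x powr p - a powr p"
    using assms False
    by (intro convex_on_imp_above_tangent[OF powr_convex[OF assms(1)]])
      (auto intro!: derivative_eq_intros simp: at_within_open[of a "{0<..}"] connected_Ioi interior_open)
  then show ?thesis
    by simp
qed

text \<open>
  Jensen's inequality for weights with sum at most 1, which holds because the function vanishes at
  0: sum the tangent inequality at the weighted mean, and note that the constant term of the tangent
  is nonpositive.
\<close>

lemma powr_jensen:
  fixes w x :: "'i \<Rightarrow> real"
  assumes p: "1 \<le> p" and w: "\<And>i. i \<in> I \<Longrightarrow> 0 \<le> w i" "(\<Sum>i\<in>I. w i) \<le> 1"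
    and x: "\<And>i. i \<in> I \<Longrightarrow> 0 \<le> x i"
  shows "(\<Sum>i\<in>I. w i * x i) powr p \<le> (\<Sum>i\<in>I. w i * x i powr p)"
proof (cases "(\<Sum>i\<in>I. w i * x i) = 0")
  case True
  then show ?thesis
    using w x by (simp add: sum_nonneg)
next
  case False
  define a where "a = (\<Sum>i\<in>I. w i * x i)"
  have a: "0 < a"
    using False w x unfolding a_def by (simp add: order_less_le sum_nonneg)
  have pa: "p * a powr (p - 1) * a = p * a powr p"
    using a by (simp add: powr_diff)
  have "a powr p = a powr p * (1 - p) * 1 + p * a powr (p - 1) * a"
    unfolding pa by (simp add: algebra_simps)
  also have "\<dots> \<le> a powr p * (1 - p) * (\<Sum>i\<in>I. w i) + p * a powr (p - 1) * a"
    using p w(2) by (intro add_right_mono mult_left_mono_neg mult_nonneg_nonpos) simp_all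
  also have "\<dots> = a powr p * (\<Sum>i\<in>I. w i) - p * a powr (p - 1) * a * (\<Sum>i\<in>I. w i)
      + p * a powr (p - 1) * (\<Sum>i\<in>I. w i * x i)"
    unfolding a_def[symmetric] pa by (simp add: algebra_simps)
  also have "\<dots> = (\<Sum>i\<in>I. w i * (a powr p + p * a powr (p - 1) * (x i - a)))"
    by (simp add: sum_distrib_left sum_distrib_right sum.distrib sum_subtractf algebra_simps)
  also have "\<dots> \<le> (\<Sum>i\<in>I. w i * x i powr p)"
    using w x by (intro sum_mono mult_left_mono powr_tangent p a) auto
  finally show ?thesis
    by (simp add: a_def)
qed

text \<open>
  Minkowski's inequality, from convexity: \<open>(a + b) / (\<alpha> + \<beta>)\<close> is the convex combination of \<open>a / \<alpha>\<close> and
  \<open>b / \<beta>\<close> with weights \<open>\<alpha> / (\<alpha> + \<beta>)\<close> and \<open>\<beta> / (\<alpha> + \<beta>)\<close>. Upper bounds \<open>\<alpha>\<close>, \<open>\<beta>\<close> instead of the norms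
  themselves keep the denominators positive.
\<close>

lemma minkowski_sum:
  fixes a b :: "'i \<Rightarrow> real"
  assumes p: "1 \<le> p" and a: "\<And>i. i \<in> I \<Longrightarrow> 0 \<le> a i" and b: "\<And>i. i \<in> I \<Longrightarrow> 0 \<le> b i"
    and \<alpha>: "0 < \<alpha>" "(\<Sum>i\<in>I. a i powr p) \<le> \<alpha> powr p"
    and \<beta>: "0 < \<beta>" "(\<Sum>i\<in>I. b i powr p) \<le> \<beta> powr p"
  shows "(\<Sum>i\<in>I. (a i + b i) powr p) \<le> (\<alpha> + \<beta>) powr p"
proof -
  define D where "D = \<alpha> + \<beta>"
  have D: "0 < D"
    using \<alpha> \<beta> by (simp add: D_def)
  have conv: "(a i + b i) powr p
      \<le> D powr p * (\<alpha> / D * (a i powr p / \<alpha> powr p) + \<beta> / D * (b i powr p / \<beta> powr p))"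
    if i: "i \<in> I" for i
  proof -
    have "(\<alpha> / D * (a i / \<alpha>) + \<beta> / D * (b i / \<beta>)) powr p
        \<le> \<alpha> / D * (a i / \<alpha>) powr p + \<beta> / D * (b i / \<beta>) powr p"
      using powr_jensen[OF p, of UNIV "\<lambda>c. if c then \<alpha> / D else \<beta> / D"
          "\<lambda>c. if c then a i / \<alpha> else b i / \<beta>"] \<alpha> \<beta> D a[OF i] b[OF i]
      by (simp add: UNIV_bool D_def add_divide_distrib[symmetric] add.commute split: if_splits)
    moreover have "a i + b i = D * (\<alpha> / D * (a i / \<alpha>) + \<beta> / D * (b i / \<beta>))"
      using \<alpha> \<beta> D by (simp add: field_simps)
    ultimately show ?thesis
      using \<alpha> \<beta> D a[OF i] b[OF i] by (simp add: powr_mult powr_divide)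
  qed
  have "(\<Sum>i\<in>I. (a i + b i) powr p)
      \<le> (\<Sum>i\<in>I. D powr p * (\<alpha> / D * (a i powr p / \<alpha> powr p) + \<beta> / D * (b i powr p / \<beta> powr p)))"
    by (rule sum_mono) (rule conv)
  also have "\<dots> = D powr p * (\<alpha> / D * ((\<Sum>i\<in>I. a i powr p) / \<alpha> powr p)
      + \<beta> / D * ((\<Sum>i\<in>I. b i powr p) / \<beta> powr p))"
    by (simp only: sum.distrib sum_distrib_left[symmetric] sum_divide_distrib[symmetric])
  also have "\<dots> \<le> D powr p * (\<alpha> / D * 1 + \<beta> / D * 1)"
    using \<alpha> \<beta> D by (intro mult_left_mono add_mono) simp_all
  also have "\<dots> = D powr p"
    using D by (simp add: D_def add_divide_distrib[symmetric])
  finally show ?thesis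
    by (simp add: D_def)
qed


section \<open>Schatten norms\<close>

lemma schatten_norm_nonneg: "0 \<le> schatten_norm p A"
  by (simp add: schatten_norm_def)

text \<open>
  The upper bound of the variational formula. Inserting the singular value decomposition
  \<open>C x = \<Sum>k. s\<^sub>k \<langle>x, u\<^sub>k\<rangle> v\<^sub>k\<close> and using \<open>a b \<le> (a\<^sup>2 + b\<^sup>2) / 2\<close>, each entry \<open>\<bar>\<langle>S C T f\<^sub>i, g\<^sub>i\<rangle>\<bar>\<close> is at most
  \<open>\<Sum>k. P\<^sub>i\<^sub>k s\<^sub>k\<close> with \<open>P\<^sub>i\<^sub>k = (\<bar>\<langle>T f\<^sub>i, u\<^sub>k\<rangle>\<bar>\<^sup>2 + \<bar>\<langle>S\<^sup>*g\<^sub>i, v\<^sub>k\<rangle>\<bar>\<^sup>2) / 2\<close>. Bessel's inequality bounds the row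
  sums of \<open>P\<close> by 1, and its column sums as well, after moving \<open>T\<close> and \<open>S\<^sup>*\<close> to the other side of the
  inner products. Jensen's inequality in each row followed by the column sums gives \<open>\<Sum>k. s\<^sub>k\<^bsup>p\<^esup>\<close>.
\<close>

lemma sum_powr_bessel_le:
  fixes C :: "complex^'n^'n"
  assumes p: "1 \<le> p" and f: "bessel f" and g: "bessel g"
    and S: "mat_norm S \<le> 1" and T: "mat_norm T \<le> 1"
  shows "(\<Sum>i\<in>UNIV. cmod (cinner ((S ** C ** T) *v f i) (g i)) powr p) \<le> schatten_norm p C powr p"
proof -
  obtain u v :: "'n \<Rightarrow> complex^'n" and s where u: "bessel u" and v: "bessel v" and s: "\<And>i. 0 \<le> s i"
    and C: "\<And>x. C *v x = (\<Sum>k\<in>UNIV. (complex_of_real (s k) * cinner x (u k)) *s v k)"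
    and norm: "schatten_norm p C = (\<Sum>i\<in>UNIV. s i powr p) powr (1 / p)"
    by (rule singular_value_decomposition[of C]) blast
  define P where "P i k = ((cmod (cinner (T *v f i) (u k)))\<^sup>2
    + (cmod (cinner (cadj S *v g i) (v k)))\<^sup>2) / 2" for i k
  have contract: "(norm (T *v x))\<^sup>2 \<le> (norm x)\<^sup>2" if "mat_norm T \<le> 1" for T and x :: "complex^'n"
  proof (intro power_mono norm_ge_zero)
    show "norm (T *v x) \<le> norm x"
      using norm_matrix_vector_le[of T x] mult_right_mono[OF that, of "norm x"] by simp
  qed
  have S': "mat_norm (cadj S) \<le> 1" and T': "mat_norm (cadj T) \<le> 1"
    using S T by (simp_all add: mat_norm_cadj)
  have row: "(\<Sum>k\<in>UNIV. (cmod (cinner (R *v h i) (w k)))\<^sup>2) \<le> 1"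
    if "mat_norm R \<le> 1" "bessel h" "bessel w" for R and h w :: "'n \<Rightarrow> complex^'n" and i
  proof -
    have "(\<Sum>k\<in>UNIV. (cmod (cinner (R *v h i) (w k)))\<^sup>2) \<le> (norm (R *v h i))\<^sup>2"
      using that(3) by (rule besselD)
    also have "\<dots> \<le> (norm (h i))\<^sup>2"
      by (rule contract) (rule that(1))
    also have "\<dots> \<le> 1"
      using bessel_norm_le_1[OF that(2)] by (simp add: power_le_one)
    finally show ?thesis .
  qed
  have rowP: "(\<Sum>k\<in>UNIV. P i k) \<le> 1" for i
    using row[OF T f u, of i] row[OF S' g v, of i]
    by (simp add: P_def sum.distrib flip: sum_divide_distrib)
  have flip: "cmod (cinner (R *v x) y) = cmod (cinner (cadj R *v y) x)" for R and x y :: "complex^'n"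
    using cinner_commute[of x "cadj R *v y"] by (simp add: cinner_adj)
  have colP: "(\<Sum>i\<in>UNIV. P i k) \<le> 1" for k
    using row[OF T' u f, of k] row[OF S v g, of k]
    by (simp add: P_def sum.distrib flip[of T] flip[of "cadj S"] flip: sum_divide_distrib)
  have P0: "0 \<le> P i k" for i k
    by (simp add: P_def)
  have entry: "cmod (cinner ((S ** C ** T) *v f i) (g i)) \<le> (\<Sum>k\<in>UNIV. P i k * s k)" for i
  proof -
    have "cinner ((S ** C ** T) *v f i) (g i) = cinner (C *v (T *v f i)) (cadj S *v g i)"
      by (simp only: matrix_vector_mul_assoc[symmetric] cinner_adj)
    also have "\<dots> = (\<Sum>k\<in>UNIV. of_real (s k) * cinner (T *v f i) (u k) * cinner (v k) (cadj S *v g i))"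
      by (simp only: C cinner_sum_left cinner_scale_left)
    also have "cmod \<dots> \<le> (\<Sum>k\<in>UNIV. s k * (cmod (cinner (T *v f i) (u k))
        * cmod (cinner (v k) (cadj S *v g i))))"
      by (rule order_trans[OF norm_sum]) (simp add: norm_mult s mult.assoc)
    also have "\<dots> \<le> (\<Sum>k\<in>UNIV. s k * P i k)"
    proof (intro sum_mono mult_left_mono s)
      fix k
      have "cmod (cinner (v k) (cadj S *v g i)) = cmod (cinner (cadj S *v g i) (v k))"
        using cinner_commute[of "v k" "cadj S *v g i"] by simp
      then show "cmod (cinner (T *v f i) (u k)) * cmod (cinner (v k) (cadj S *v g i)) \<le> P i k"
        using sum_squares_bound[of "cmod (cinner (T *v f i) (u k))" "cmod (cinner (v k) (cadj S *v g i))"]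
        by (simp add: P_def)
    qed
    finally show ?thesis
      by (simp add: mult.commute)
  qed
  have "(\<Sum>i\<in>UNIV. cmod (cinner ((S ** C ** T) *v f i) (g i)) powr p)
      \<le> (\<Sum>i\<in>UNIV. (\<Sum>k\<in>UNIV. P i k * s k) powr p)"
    using p by (intro sum_mono powr_mono2 entry) simp_all
  also have "\<dots> \<le> (\<Sum>i\<in>UNIV. \<Sum>k\<in>UNIV. P i k * s k powr p)"
    by (intro sum_mono powr_jensen p P0 rowP s)
  also have "\<dots> = (\<Sum>k\<in>UNIV. (\<Sum>i\<in>UNIV. P i k) * s k powr p)"
    by (subst sum.swap) (simp add: sum_distrib_right)
  also have "\<dots> \<le> (\<Sum>k\<in>UNIV. 1 * s k powr p)"
    by (intro sum_mono mult_right_mono colP) simp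
  also have "\<dots> = schatten_norm p C powr p"
    using p by (simp add: norm powr_powr sum_nonneg)
  finally show ?thesis .
qed

text \<open>The maximum in the variational formula is attained at the singular vectors of \<open>A\<close>.\<close>

lemma schatten_norm_least:
  fixes A :: "complex^'n^'n"
  assumes p: "1 \<le> p" and b: "0 \<le> b"
    and le: "\<And>u v. \<lbrakk>bessel u; bessel v\<rbrakk>
      \<Longrightarrow> (\<Sum>i\<in>UNIV. cmod (cinner (A *v u i) (v i)) powr p) \<le> b powr p"
  shows "schatten_norm p A \<le> b"
proof -
  obtain u v :: "'n \<Rightarrow> complex^'n" and s where u: "bessel u" and v: "bessel v" and s: "\<And>i. 0 \<le> s i"
    and diag: "\<And>i. cinner (A *v u i) (v i) = complex_of_real (s i)"
    and norm: "schatten_norm p A = (\<Sum>i\<in>UNIV. s i powr p) powr (1 / p)"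
    by (rule singular_value_decomposition[of A]) blast
  have "(\<Sum>i\<in>UNIV. s i powr p) \<le> b powr p"
    using le[OF u v] s by (simp add: diag)
  then have "schatten_norm p A \<le> (b powr p) powr (1 / p)"
    unfolding norm using p by (intro powr_mono2) (simp_all add: sum_nonneg)
  then show ?thesis
    using p b by (simp add: powr_powr)
qed

lemma schatten_norm_upper:
  assumes "1 \<le> p" "bessel u" "bessel v"
  shows "(\<Sum>i\<in>UNIV. cmod (cinner (A *v u i) (v i)) powr p) \<le> schatten_norm p A powr p"
  using sum_powr_bessel_le[OF assms mat_norm_mat_1 mat_norm_mat_1, of A] by simp

lemma schatten_norm_contractions:
  assumes "1 \<le> p" "mat_norm S \<le> 1" "mat_norm T \<le> 1"
  shows "schatten_norm p (S ** C ** T) \<le> schatten_norm p C"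
  using assms by (intro schatten_norm_least schatten_norm_nonneg sum_powr_bessel_le)

text \<open>
  For fixed Bessel families this is Minkowski's inequality. The margin \<open>e\<close> provides the positive
  bounds that \<open>minkowski_sum\<close> asks for when one of the norms vanishes.
\<close>

lemma schatten_norm_triangle:
  fixes A B :: "complex^'n^'n"
  assumes p: "1 \<le> p"
  shows "schatten_norm p (A + B) \<le> schatten_norm p A + schatten_norm p B"
proof (rule field_le_epsilon)
  fix e :: real assume e: "0 < e"
  define \<alpha> \<beta> where "\<alpha> = schatten_norm p A + e / 2" and "\<beta> = schatten_norm p B + e / 2"
  have pos: "0 < \<alpha>" "0 < \<beta>"
    using e schatten_norm_nonneg[of p A] schatten_norm_nonneg[of p B] by (simp_all add: \<alpha>_def \<beta>_def)
  have "schatten_norm p (A + B) \<le> \<alpha> + \<beta>"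
  proof (rule schatten_norm_least[OF p])
    fix u v :: "'n \<Rightarrow> complex^'n" assume uv: "bessel u" "bessel v"
    let ?a = "\<lambda>i. cmod (cinner (A *v u i) (v i))" and ?b = "\<lambda>i. cmod (cinner (B *v u i) (v i))"
    have "(\<Sum>i\<in>UNIV. ?a i powr p) \<le> schatten_norm p A powr p"
      by (rule schatten_norm_upper[OF p uv])
    also have "\<dots> \<le> \<alpha> powr p"
      using p e by (intro powr_mono2) (simp_all add: \<alpha>_def schatten_norm_nonneg)
    finally have a: "(\<Sum>i\<in>UNIV. ?a i powr p) \<le> \<alpha> powr p" .
    have "(\<Sum>i\<in>UNIV. ?b i powr p) \<le> schatten_norm p B powr p"
      by (rule schatten_norm_upper[OF p uv])
    also have "\<dots> \<le> \<beta> powr p"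
      using p e by (intro powr_mono2) (simp_all add: \<beta>_def schatten_norm_nonneg)
    finally have b: "(\<Sum>i\<in>UNIV. ?b i powr p) \<le> \<beta> powr p" .
    have "(\<Sum>i\<in>UNIV. cmod (cinner ((A + B) *v u i) (v i)) powr p) \<le> (\<Sum>i\<in>UNIV. (?a i + ?b i) powr p)"
      using p by (intro sum_mono powr_mono2)
        (simp_all add: matrix_vector_mult_add_rdistrib cinner_add_left norm_triangle_ineq)
    also have "\<dots> \<le> (\<alpha> + \<beta>) powr p"
      by (rule minkowski_sum[OF p _ _ pos(1) a pos(2) b]) simp_all
    finally show "(\<Sum>i\<in>UNIV. cmod (cinner ((A + B) *v u i) (v i)) powr p) \<le> (\<alpha> + \<beta>) powr p" .
  qed (use pos in simp)
  then show "schatten_norm p (A + B) \<le> schatten_norm p A + schatten_norm p B + e"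
    by (simp add: \<alpha>_def \<beta>_def)
qed

lemma schatten_norm_scaleR_le:
  fixes A :: "complex^'n^'n"
  assumes p: "1 \<le> p" and r: "0 \<le> r"
  shows "schatten_norm p (r *\<^sub>R A) \<le> r * schatten_norm p A"
proof (rule schatten_norm_least[OF p])
  fix u v :: "'n \<Rightarrow> complex^'n" assume uv: "bessel u" "bessel v"
  have "cmod (cinner ((r *\<^sub>R A) *v x) y) = r * cmod (cinner (A *v x) y)" for x y
  proof -
    have "(r *\<^sub>R A) *v x = complex_of_real r *s (A *v x)"
      by (simp add: vec_eq_iff matrix_vector_mult_def sum_distrib_left
          scaleR_conv_of_real[where 'a = complex] mult.assoc)
    then show ?thesis
      using r by (simp add: cinner_scale_left norm_mult)
  qed
  then have "(\<Sum>i\<in>UNIV. cmod (cinner ((r *\<^sub>R A) *v u i) (v i)) powr p)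
      = r powr p * (\<Sum>i\<in>UNIV. cmod (cinner (A *v u i) (v i)) powr p)"
    using r by (simp add: powr_mult sum_distrib_left)
  also have "\<dots> \<le> r powr p * schatten_norm p A powr p"
    by (intro mult_left_mono schatten_norm_upper[OF p uv]) simp
  finally show "(\<Sum>i\<in>UNIV. cmod (cinner ((r *\<^sub>R A) *v u i) (v i)) powr p)
      \<le> (r * schatten_norm p A) powr p"
    using r by (simp add: powr_mult schatten_norm_nonneg)
qed (use r in \<open>simp add: schatten_norm_nonneg\<close>)

text \<open>Bessel families lie in the unit ball, so each of the \<open>n\<close> terms is at most \<open>\<parallel>A\<parallel>\<^bsup>p\<^esup>\<close>.\<close>

lemma schatten_norm_le_mat_norm:
  fixes A :: "complex^'n^'n"
  assumes p: "1 \<le> p"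
  shows "schatten_norm p A \<le> real CARD('n) powr (1 / p) * mat_norm A"
proof (rule schatten_norm_least[OF p])
  fix u v :: "'n \<Rightarrow> complex^'n" assume uv: "bessel u" "bessel v"
  have "cmod (cinner (A *v u i) (v i)) \<le> mat_norm A" for i
  proof -
    have "cmod (cinner (A *v u i) (v i)) \<le> norm (A *v u i) * norm (v i)"
      by (rule cmod_cinner_le)
    also have "\<dots> \<le> (mat_norm A * 1) * 1"
      by (intro mult_mono order_trans[OF norm_matrix_vector_le] mult_left_mono bessel_norm_le_1 uv
          mat_norm_nonneg) (simp_all add: mat_norm_nonneg)
    finally show ?thesis
      by simp
  qed
  then have "(\<Sum>i\<in>UNIV. cmod (cinner (A *v u i) (v i)) powr p) \<le> (\<Sum>i\<in>(UNIV :: 'n set). mat_norm A powr p)"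
    using p by (intro sum_mono powr_mono2) simp_all
  also have "\<dots> = (real CARD('n) powr (1 / p) * mat_norm A) powr p"
    using p by (simp add: powr_mult powr_powr mat_norm_nonneg)
  finally show "(\<Sum>i\<in>UNIV. cmod (cinner (A *v u i) (v i)) powr p)
      \<le> (real CARD('n) powr (1 / p) * mat_norm A) powr p" .
qed (simp add: mat_norm_nonneg)

section \<open>The complex line from a matrix to the identity\<close>

text \<open>By Leibniz' formula the determinant is a polynomial in \<open>z\<close>, and it is not zero at \<open>z0\<close>.\<close>

lemma det_pencil_finite:
  fixes M N :: "complex^'n^'n"
  assumes "det (M + mat z0 ** N) \<noteq> 0"
  shows "finite {z. det (M + mat z ** N) = 0}"
proof -
  define q where "q = (\<Sum>\<sigma>\<in>{\<sigma>. \<sigma> permutes (UNIV :: 'n set)}.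
    [:of_int (sign \<sigma>):] * (\<Prod>i\<in>UNIV. [:M $ i $ \<sigma> i, N $ i $ \<sigma> i:]))"
  have entry: "(mat z ** N) $ i $ k = z * N $ i $ k" for z i k
    by (simp add: matrix_matrix_mult_def mat_def if_distrib[of "\<lambda>c. c * _"] cong del: if_weak_cong)
  have "poly q z = det (M + mat z ** N)" for z
    by (simp add: q_def det_def poly_sum poly_prod entry)
  then have "q \<noteq> 0" "{z. det (M + mat z ** N) = 0} = {z. poly q z = 0}"
    using assms by auto
  then show ?thesis
    by (simp add: poly_roots_finite)
qed

definition to_id :: "complex^'n^'n \<Rightarrow> complex \<Rightarrow> complex^'n^'n" where
  "to_id A z = A + mat z ** (mat 1 - A)"

lemma to_id_0: "to_id A 0 = A"
  by (simp add: to_id_def matrix_matrix_mult_def vec_eq_iff mat_def)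

lemma to_id_1: "to_id A 1 = mat 1"
  by (simp add: to_id_def)

lemma finite_singular_to_id: "finite {z. \<not> invertible (to_id A z)}"
  using det_pencil_finite[of A 1 "mat 1 - A"]
  by (simp add: to_id_def invertible_det_nz)

lemma mat_norm_to_id_diff:
  fixes A :: "complex^'n^'n"
  shows "mat_norm (to_id A z - to_id A w) \<le> cmod (z - w) * mat_norm (mat 1 - A)"
proof (rule mat_norm_least)
  fix x
  have eq: "(to_id A z - to_id A w) *v x = (z - w) *s ((mat 1 - A) *v x)"
    by (simp add: to_id_def matrix_vector_mult_diff_rdistrib matrix_vector_mult_add_rdistrib
        mat_vector_mult vector_sub_rdistrib flip: matrix_vector_mul_assoc)
  show "norm ((to_id A z - to_id A w) *v x) \<le> cmod (z - w) * mat_norm (mat 1 - A) * norm x"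
    using norm_matrix_vector_le[of "mat 1 - A" x]
    unfolding eq norm_vector_scale mult.assoc by (rule mult_left_mono) simp
qed

text \<open>The parameter can be chosen real because every interval \<open>(0, d)\<close> is infinite; this preserves
  self-adjointness.\<close>

lemma invertible_to_id_near:
  fixes A :: "complex^'n^'n"
  assumes "0 < e"
  obtains t :: real where "invertible (to_id A (of_real t))" "mat_norm (A - to_id A (of_real t)) < e"
proof -
  define d where "d = e / (mat_norm (mat 1 - A) + 1)"
  have d: "0 < d"
    using assms mat_norm_nonneg[of "mat 1 - A"] by (simp add: d_def)
  have "inj complex_of_real"
    by (rule injI) (simp only: of_real_eq_iff)
  then have "finite (complex_of_real -` {z. \<not> invertible (to_id A z)})"
    by (rule finite_vimageI[OF finite_singular_to_id])
  moreover have "infinite {0<..<d}"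
    using d by (rule infinite_Ioo)
  ultimately have "\<not> {0<..<d} \<subseteq> complex_of_real -` {z. \<not> invertible (to_id A z)}"
    using finite_subset by blast
  then obtain t where t: "0 < t" "t < d" "invertible (to_id A (complex_of_real t))"
    unfolding subset_iff greaterThanLessThan_iff vimage_eq mem_Collect_eq by blast
  have "mat_norm (A - to_id A (of_real t)) \<le> t * mat_norm (mat 1 - A)"
    using mat_norm_to_id_diff[of A 0 "of_real t"] t(1) by (simp add: to_id_0)
  also have "\<dots> \<le> t * (mat_norm (mat 1 - A) + 1)"
    using t(1) by simp
  also have "\<dots> < d * (mat_norm (mat 1 - A) + 1)"
    using t(2) mat_norm_nonneg[of "mat 1 - A"] by (intro mult_strict_right_mono) simp_all
  also have "\<dots> = e"
    using mat_norm_nonneg[of "mat 1 - A"] by (simp add: d_def)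
  finally show ?thesis
    using that t(3) by blast
qed

lemma cadj_to_id:
  fixes A :: "complex^'n^'n"
  assumes "cadj A = A"
  shows "cadj (to_id A (of_real t)) = to_id A (of_real t)"
proof -
  have "X ** mat a = mat a ** X" for X :: "complex^'n^'n" and a
    unfolding matrix_eq matrix_vector_mul_assoc[symmetric] mat_vector_mult matrix_vector_scale
    by blast
  then show ?thesis
    by (simp only: to_id_def cadj_add cadj_mult cadj_diff cadj_mat assms complex_cnj_complex_of_real
        complex_cnj_one)
qed

section \<open>Matrices as the operators on a Hilbert space\<close>

text \<open>
  Hilbert space structures over a type \<open>'u\<close> have their vectors in \<open>'u\<close>, so \<open>\<complex>\<^sup>n\<close> enters as the copy of
  itself under an injection \<open>j\<close>.
\<close>

locale coordinate_copy =
  fixes j :: "complex^'n \<Rightarrow> 'u"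
  assumes inj_j: "inj j"
begin

definition hilb :: "'u hilbert" where
  "hilb = \<lparr>car = range j, zer = j 0,
     add = (\<lambda>a b. j (inv j a + inv j b)),
     scl = (\<lambda>c a. j (c *s inv j a)),
     inn = (\<lambda>a b. cinner (inv j a) (inv j b))\<rparr>"

lemma hilb_simps [simp]:
  "car hilb = range j"
  "zer hilb = j 0"
  "add hilb (j x) (j y) = j (x + y)"
  "scl hilb c (j x) = j (c *s x)"
  "inn hilb (j x) (j y) = cinner x y"
  by (simp_all add: hilb_def inj_j)

lemma j_eq [simp]: "j x = j y \<longleftrightarrow> x = y"
  using inj_j by (simp add: inj_eq)

lemma hnorm_hilb [simp]: "hnorm hilb (j x) = norm x"
  by (simp add: hnorm_def cinner_self)

lemma hdist_hilb [simp]: "hdist hilb (j x) (j y) = dist x y"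
  by (simp add: hdist_def dist_norm)

lemma complex_pre_hilbert_hilb: "complex_pre_hilbert hilb"
proof
  fix x assume "x \<in> car hilb"
  then obtain a where a: "x = j a" by auto
  show "\<exists>y\<in>car hilb. add hilb x y = zer hilb"
    unfolding a by (rule bexI[of _ "j (- a)"]) simp_all
next
  fix x y assume "x \<in> car hilb" "y \<in> car hilb"
  then show "inn hilb x y = cnj (inn hilb y x)"
    by (auto intro: cinner_commute)
next
  fix x y a assume "x \<in> car hilb" "y \<in> car hilb"
  then show "inn hilb (scl hilb a x) y = a * inn hilb x y"
    by (auto simp: cinner_scale_left)
next
  fix x y z assume "x \<in> car hilb" "y \<in> car hilb" "z \<in> car hilb"
  then show "inn hilb (add hilb x y) z = inn hilb x z + inn hilb y z"
    by (auto simp: cinner_add_left)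
qed (auto simp: add.assoc add.commute vector_add_ldistrib vector_sadd_rdistrib vector_smult_assoc
    cinner_self simp del: of_real_power)

sublocale complex_pre_hilbert hilb
  by (rule complex_pre_hilbert_hilb)

lemma complex_hilbert_hilb: "complex_hilbert hilb"
proof
  interpret M: Metric_space "car hilb" "hdist hilb"
    by (rule Metric_space_hdist)
  show "M.mcomplete"
    unfolding M.mcomplete_def
  proof (intro allI impI)
    fix \<sigma> assume \<sigma>: "M.MCauchy \<sigma>"
    define \<tau> where "\<tau> n = inv j (\<sigma> n)" for n
    have "\<sigma> n \<in> car hilb" for n
      using \<sigma> unfolding M.MCauchy_def by blast
    then have \<sigma>\<tau>: "\<sigma> n = j (\<tau> n)" for n
      by (simp add: \<tau>_def f_inv_into_f)
    have "Cauchy \<tau>"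
      using \<sigma> unfolding Cauchy_def M.MCauchy_def by (simp add: \<sigma>\<tau>)
    then obtain l where "\<tau> \<longlonglongrightarrow> l"
      using Cauchy_convergent_iff convergent_def by blast
    then have "\<forall>r>0. \<exists>N. \<forall>n\<ge>N. \<sigma> n \<in> car hilb \<and> hdist hilb (\<sigma> n) (j l) < r"
      by (simp add: \<sigma>\<tau> lim_sequentially)
    then have "limitin M.mtopology \<sigma> (j l) sequentially"
      unfolding M.limit_metric_sequentially by simp
    then show "\<exists>x. limitin M.mtopology \<sigma> x sequentially" ..
  qed
qed

definition op_of :: "complex^'n^'n \<Rightarrow> 'u \<Rightarrow> 'u" where
  "op_of A = (\<lambda>x\<in>range j. j (A *v inv j x))"

lemma op_of_j [simp]: "op_of A (j x) = j (A *v x)"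
  by (simp add: op_of_def inj_j)

lemma op_of_extensional: "op_of A \<in> extensional (range j)"
  by (simp add: op_of_def)

lemma op_eqI:
  assumes "S \<in> extensional (range j)" "T \<in> extensional (range j)" "\<And>x. S (j x) = T (j x)"
  shows "S = T"
  using assms by (intro extensionalityI[of S "range j"]) auto

lemma op_of_eq [simp]: "op_of A = op_of B \<longleftrightarrow> A = B"
proof
  assume "op_of A = op_of B"
  then have "op_of A (j x) = op_of B (j x)" for x
    by simp
  then show "A = B"
    by (simp add: matrix_eq)
qed simp

lemma bounded_ops_hilb: "bounded_ops hilb = range op_of"
proof
  show "range op_of \<subseteq> bounded_ops hilb"
  proof
    fix T assume "T \<in> range op_of"
    then obtain A where T: "T = op_of A"
      by blast
    have "\<exists>K. \<forall>x\<in>range j. hnorm hilb (op_of A x) \<le> K * hnorm hilb x"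
      by (rule exI[of _ "mat_norm A"]) (simp add: norm_matrix_vector_le)
    then show "T \<in> bounded_ops hilb"
      by (auto simp: bounded_ops_def T op_of_extensional PiE_iff matrix_vector_right_distrib
          matrix_vector_scale)
  qed
  show "bounded_ops hilb \<subseteq> range op_of"
  proof
    fix T assume T: "T \<in> bounded_ops hilb"
    define f where "f x = inv j (T (j x))" for x
    have Tj: "T (j x) = j (f x)" for x
      using bounded_opsD(1)[OF T, of "j x"] by (auto simp: f_def f_inv_into_f)
    have "f (x + y) = f x + f y" for x y
      using bounded_opsD(2)[OF T, of "j x" "j y"] by (simp add: Tj)
    moreover have "f (c *s x) = c *s f x" for c x
      using bounded_opsD(3)[OF T, of "j x" c] by (simp add: Tj)
    ultimately have "Vector_Spaces.linear (*s) (*s) f"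
      by unfold_locales (simp_all add: vector_add_ldistrib vector_sadd_rdistrib vector_smult_assoc)
    then have "T = op_of (matrix f)"
      using T by (intro op_eqI) (auto simp: bounded_ops_def PiE_def op_of_extensional Tj matrix_works)
    then show "T \<in> range op_of"
      by blast
  qed
qed

lemma op_of_bounded: "op_of A \<in> bounded_ops hilb"
  by (simp add: bounded_ops_hilb)

lemma op_of_mem_image [simp]: "op_of A \<in> op_of ` S \<longleftrightarrow> A \<in> S"
  by auto

lemma op_id_hilb: "op_id hilb = op_of (mat 1)"
  by (rule op_eqI) (simp_all add: op_id_def op_of_extensional)

lemma op_add_hilb [simp]: "op_add hilb (op_of A) (op_of B) = op_of (A + B)"
  by (rule op_eqI) (simp_all add: op_add_def op_of_extensional matrix_vector_mult_add_rdistrib)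

lemma op_scale_hilb [simp]: "op_scale hilb a (op_of A) = op_of (mat a ** A)"
  by (rule op_eqI) (simp_all add: op_scale_def op_of_extensional mat_vector_mult
      flip: matrix_vector_mul_assoc)

lemma op_mult_hilb [simp]: "op_mult hilb (op_of A) (op_of B) = op_of (A ** B)"
  by (rule op_eqI) (simp_all add: op_mult_def op_of_extensional compose_eq
      flip: matrix_vector_mul_assoc)

lemma op_diff_hilb [simp]: "op_diff hilb (op_of A) (op_of B) = op_of (A - B)"
proof -
  have "A + mat (- 1) ** B = A - B"
    by (simp add: matrix_eq matrix_vector_mult_add_rdistrib mat_vector_mult
        matrix_vector_mult_diff_rdistrib flip: matrix_vector_mul_assoc)
  then show ?thesis
    by (simp add: op_diff_def)
qed

lemma op_adj_hilb [simp]: "op_adj hilb (op_of A) = op_of (cadj A)"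
  unfolding op_adj_def
proof (rule the_equality)
  show "op_of (cadj A) \<in> bounded_ops hilb \<and> (\<forall>x\<in>car hilb. \<forall>y\<in>car hilb.
      inn hilb (op_of A x) y = inn hilb x (op_of (cadj A) y))"
    by (simp add: bounded_ops_hilb cinner_adj)
next
  fix S assume S: "S \<in> bounded_ops hilb \<and> (\<forall>x\<in>car hilb. \<forall>y\<in>car hilb.
      inn hilb (op_of A x) y = inn hilb x (S y))"
  then obtain B where B: "S = op_of B"
    by (auto simp: bounded_ops_hilb)
  have "cinner x (B *v y) = cinner x (cadj A *v y)" for x y
    using S by (simp add: B flip: cinner_adj)
  then have "B *v y = cadj A *v y" for y
    by (rule cinner_eqI)
  then show "S = op_of (cadj A)"
    by (simp add: B matrix_eq)
qed

lemma op_norm_hilb [simp]: "op_norm hilb (op_of A) = mat_norm A"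
proof (rule antisym)
  have A: "op_of A \<in> bounded_ops hilb"
    by (simp add: bounded_ops_hilb)
  show "op_norm hilb (op_of A) \<le> mat_norm A"
  proof (rule op_norm_least)
    fix x assume "x \<in> car hilb" "hnorm hilb x \<le> 1"
    then obtain a where a: "x = j a" "norm a \<le> 1"
      by auto
    show "hnorm hilb (op_of A x) \<le> mat_norm A"
      using norm_matrix_vector_le[of A a] mult_left_mono[OF a(2) mat_norm_nonneg[of A]]
      by (simp add: a(1))
  qed
  show "mat_norm A \<le> op_norm hilb (op_of A)"
  proof (rule mat_norm_least)
    fix x show "norm (A *v x) \<le> op_norm hilb (op_of A) * norm x"
      using hnorm_op_le[OF A, of "j x"] by simp
  qed
qed

lemma op_commutator_hilb [simp]:
  "op_commutator hilb (op_of A) (op_of B) = op_of (A ** B - B ** A)"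
  by (simp add: op_commutator_def)

lemma op_dist_hilb [simp]: "op_dist hilb (op_of A) (op_of B) = mat_norm (A - B)"
  by (simp add: op_dist_def bounded_ops_hilb)

lemma topspace_op_topology: "topspace (op_topology hilb) = range op_of"
  using Metric_space.topspace_mtopology[OF Metric_space_op_dist]
  by (simp add: op_topology_def bounded_ops_hilb)

text \<open>
  The metric topology of the operators is that of the operator norm on matrices, so closures can be
  computed there.
\<close>

lemma closure_of_hilb:
  "op_topology hilb closure_of (op_of ` S) = op_of ` {A. \<forall>r>0. \<exists>B\<in>S. mat_norm (A - B) < r}"
proof -
  interpret M: Metric_space "bounded_ops hilb" "op_dist hilb"
    by (rule Metric_space_op_dist)
  have "{T \<in> bounded_ops hilb. P T} = op_of ` {A. P (op_of A)}" for P
    by (auto simp: bounded_ops_hilb)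
  moreover have "op_of B \<in> M.mball (op_of A) r \<longleftrightarrow> mat_norm (A - B) < r" for A B r
    by (simp only: M.in_mball op_of_bounded op_dist_hilb simp_thms)
  ultimately show ?thesis
    by (simp only: op_topology_def M.metric_closure_of bex_simps(7))
qed

lemma unital_cstar_algebra_hilb: "unital_cstar_algebra hilb (range op_of)"
  using closedin_topspace[of "op_topology hilb"]
  by (auto simp: unital_cstar_algebra_def bounded_ops_hilb op_id_hilb topspace_op_topology)

lemma invertibles_hilb: "invertibles hilb (range op_of) = op_of ` {A. invertible A}"
  by (auto simp: invertibles_def invertible_def op_id_hilb)

lemma selfadjoints_hilb: "selfadjoints hilb (range op_of) = op_of ` {A. cadj A = A}"
  by (auto simp: selfadjoints_def)

lemma normals_hilb: "normals hilb (range op_of) = op_of ` normal_mats"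
  by (auto simp: normals_def normal_mats_def)

lemma op_ball_hilb: "op_ball hilb (range op_of) r = op_of ` {A. mat_norm A \<le> r}"
  by (auto simp: op_ball_def)

text \<open>
  Density is the line from a self-adjoint \<open>A\<close> to the identity with a small real parameter. Conversely,
  limits of self-adjoint matrices are self-adjoint because the adjoint is isometric.
\<close>

lemma real_rank_zero_hilb: "real_rank_zero hilb (range op_of)"
proof -
  have "{A :: complex^'n^'n. \<forall>r>0. \<exists>B\<in>{A. invertible A \<and> cadj A = A}. mat_norm (A - B) < r}
      = {A. cadj A = A}"
    (is "?L = ?R")
  proof
    show "?R \<subseteq> ?L"
    proof (intro subsetI CollectI allI impI)
      fix A :: "complex^'n^'n" and r :: real assume "A \<in> ?R" and "0 < r"
      then have A: "cadj A = A"
        by simp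
      from \<open>0 < r\<close> obtain t where "invertible (to_id A (of_real t))" "mat_norm (A - to_id A (of_real t)) < r"
        using invertible_to_id_near by blast
      then show "\<exists>B\<in>{A. invertible A \<and> cadj A = A}. mat_norm (A - B) < r"
        using cadj_to_id[OF A] by blast
    qed
    show "?L \<subseteq> ?R"
    proof
      fix A assume A: "A \<in> ?L"
      have "mat_norm (cadj A - A) \<le> 0 + e" if e: "0 < e" for e
      proof -
        obtain B where B: "cadj B = B" "mat_norm (A - B) < e / 2"
          using A half_gt_zero[OF e] by blast
        have eq: "cadj A - A = cadj (A - B) + (B - A)"
          by (simp add: cadj_diff B(1))
        have "mat_norm (cadj A - A) \<le> mat_norm (A - B) + mat_norm (A - B)"
          using mat_norm_triangle[of "cadj (A - B)" "B - A"]
          unfolding eq mat_norm_cadj mat_norm_minus_commute[of B A] .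
        then show ?thesis
          using B(2) by simp
      qed
      then have "mat_norm (cadj A - A) \<le> 0"
        by (rule field_le_epsilon)
      then have "mat_norm (cadj A - A) * norm x \<le> 0" for x :: "complex^'n"
        by (simp add: mult_nonpos_nonneg)
      then have "norm ((cadj A - A) *v x) \<le> 0" for x
        using norm_matrix_vector_le order_trans by blast
      then show "A \<in> ?R"
        by (simp add: matrix_eq matrix_vector_mult_diff_rdistrib)
    qed
  qed
  moreover have "op_of ` {A. invertible A} \<inter> op_of ` {A. cadj A = A}
      = op_of ` {A. invertible A \<and> cadj A = A}"
    by auto
  ultimately show ?thesis
    by (simp add: real_rank_zero_def invertibles_hilb selfadjoints_hilb closure_of_hilb)
qed

lemma continuous_to_id: "continuous_map euclidean (op_topology hilb) (\<lambda>z. op_of (to_id A z))"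
proof -
  interpret M: Metric_space "bounded_ops hilb" "op_dist hilb"
    by (rule Metric_space_op_dist)
  show ?thesis
    unfolding op_topology_def M.continuous_map_to_metric
  proof (intro ballI allI impI)
    fix z and e :: real assume e: "0 < e"
    define c where "c = mat_norm (mat 1 - A) + 1"
    have c: "0 < c"
      using mat_norm_nonneg[of "mat 1 - A"] by (simp add: c_def)
    have "mat_norm (to_id A z - to_id A w) < e" if "w \<in> ball z (e / c)" for w
    proof -
      have "mat_norm (to_id A z - to_id A w) \<le> cmod (z - w) * c"
        by (rule order_trans[OF mat_norm_to_id_diff]) (simp add: c_def mult_left_mono)
      also have "\<dots> < e"
        using that c by (simp add: dist_norm pos_less_divide_eq)
      finally show ?thesis .
    qed
    then show "\<exists>U. openin euclidean U \<and> z \<in> U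
        \<and> (\<forall>w\<in>U. op_of (to_id A w) \<in> M.mball (op_of (to_id A z)) e)"
      using e c by (intro exI[of _ "ball z (e / c)"])
        (simp add: M.in_mball op_of_bounded)
  qed
qed

text \<open>
  Removing the finitely many parameters of singular matrices from the complex line through \<open>A\<close> and
  \<open>I\<close> leaves a connected set of invertible matrices that contains both.
\<close>

lemma invertibles0_hilb: "op_of ` {A. invertible A} \<subseteq> invertibles0 hilb (range op_of)"
proof clarify
  fix A :: "complex^'n^'n" assume A: "invertible A"
  define G where "G = {z. invertible (to_id A z)}"
  have "G = UNIV - {z. \<not> invertible (to_id A z)}"
    by (auto simp: G_def)
  then have "connected G"
    using connected_open_diff_countable[of "UNIV :: complex set" "{z. \<not> invertible (to_id A z)}"]
      countable_finite[OF finite_singular_to_id[of A]]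
    by (simp add: connected_UNIV)
  then have "connectedin (op_topology hilb) ((\<lambda>z. op_of (to_id A z)) ` G)"
    by (intro connectedin_continuous_map_image[OF continuous_to_id]) simp
  then have "connectedin (subtopology (op_topology hilb) (invertibles hilb (range op_of)))
      ((\<lambda>z. op_of (to_id A z)) ` G)"
    by (auto simp: connectedin_subtopology invertibles_hilb G_def)
  moreover have "op_of A \<in> (\<lambda>z. op_of (to_id A z)) ` G"
    using A by (intro image_eqI[of _ _ 0]) (simp_all add: G_def to_id_0)
  moreover have "op_id hilb \<in> (\<lambda>z. op_of (to_id A z)) ` G"
    by (intro image_eqI[of _ _ 1]) (simp_all add: G_def to_id_1 op_id_hilb invertible_det_nz)
  ultimately show "op_of A \<in> invertibles0 hilb (range op_of)"
    unfolding invertibles0_def connected_component_of_def by auto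
qed

lemma condition_C_hilb: "condition_C hilb (range op_of) (op_of A)"
proof -
  have "op_of B \<in> op_topology hilb closure_of invertibles0 hilb (range op_of)" for B
  proof -
    have "\<exists>C\<in>{A. invertible A}. mat_norm (B - C) < r" if "0 < r" for r
      by (rule invertible_to_id_near[OF that, of B]) blast
    then have "op_of B \<in> op_topology hilb closure_of (op_of ` {A. invertible A})"
      by (simp add: closure_of_hilb)
    then show ?thesis
      using closure_of_mono[OF invertibles0_hilb] by blast
  qed
  then show ?thesis
    by (simp add: condition_C_def op_id_hilb)
qed

text \<open>
  The matrices whose operator norm and Schatten norm are bounded by those of \<open>C\<close> form a convex set
  that contains the generators of the hull.
\<close>

lemma M_hull_hilb:
  assumes T: "T \<in> M_hull hilb (range op_of) (op_of C)" and p: "1 \<le> p"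
  obtains X where "T = op_of X" "mat_norm X \<le> mat_norm C" "schatten_norm p X \<le> schatten_norm p C"
proof -
  define K :: "(complex^'n^'n) set" where "K = {X. mat_norm X \<le> mat_norm C \<and> schatten_norm p X \<le> schatten_norm p C}"
  have "{op_mult hilb (op_mult hilb S1 (op_of C)) S2 |S1 S2.
      S1 \<in> op_ball hilb (range op_of) 1 \<and> S2 \<in> op_ball hilb (range op_of) 1} \<subseteq> op_of ` K"
  proof clarify
    fix S1 S2 assume "S1 \<in> op_ball hilb (range op_of) 1" "S2 \<in> op_ball hilb (range op_of) 1"
    then obtain S T where ST: "S1 = op_of S" "mat_norm S \<le> 1" "S2 = op_of T" "mat_norm T \<le> 1"
      by (auto simp: op_ball_hilb)
    have "mat_norm (S ** C ** T) \<le> mat_norm S * mat_norm C * mat_norm T"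
      by (rule order_trans[OF mat_norm_mult]) (intro mult_right_mono mat_norm_mult mat_norm_nonneg)
    also have "\<dots> \<le> 1 * mat_norm C * 1"
      using ST by (intro mult_mono) (simp_all add: mat_norm_nonneg)
    finally show "op_mult hilb (op_mult hilb S1 (op_of C)) S2 \<in> op_of ` K"
      using schatten_norm_contractions[OF p ST(2,4), of C] by (simp add: ST K_def)
  qed
  moreover have "op_convex hilb (op_of ` K)"
    unfolding op_convex_def
  proof clarify
    fix X Y and a b :: real
    assume X: "X \<in> K" and Y: "Y \<in> K" and ab: "0 \<le> a" "0 \<le> b" "a + b = 1"
    have convex: "N (a *\<^sub>R X + b *\<^sub>R Y) \<le> N C"
      if tri: "\<And>A B. N (A + B) \<le> N A + N B" and sc: "\<And>r A. 0 \<le> r \<Longrightarrow> N (r *\<^sub>R A) \<le> r * N A"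
        and le: "N X \<le> N C" "N Y \<le> N C" for N :: "complex^'n^'n \<Rightarrow> real"
    proof -
      have "N (a *\<^sub>R X + b *\<^sub>R Y) \<le> a * N X + b * N Y"
        using tri[of "a *\<^sub>R X" "b *\<^sub>R Y"] sc[OF ab(1), of X] sc[OF ab(2), of Y] by linarith
      also have "\<dots> \<le> a * N C + b * N C"
        using ab le by (intro add_mono mult_left_mono)
      also have "\<dots> = N C"
        using ab(3) by (simp flip: distrib_right)
      finally show ?thesis .
    qed
    have "a *\<^sub>R X + b *\<^sub>R Y \<in> K"
      using X Y convex[of mat_norm] convex[of "schatten_norm p"] unfolding K_def
      by (simp add: mat_norm_triangle mat_norm_scaleR schatten_norm_triangle[OF p]
          schatten_norm_scaleR_le[OF p])
    then show "op_add hilb (op_scale hilb (complex_of_real a) (op_of X))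
        (op_scale hilb (complex_of_real b) (op_of Y)) \<in> op_of ` K"
      by (simp add: mat_of_real_mult)
  qed
  ultimately have "M_hull hilb (range op_of) (op_of C) \<subseteq> op_of ` K"
    unfolding M_hull_def by (rule hull_minimal)
  then show ?thesis
    using T that by (auto simp: K_def)
qed

end


section \<open>The distance to the normal matrices\<close>

theorem mainTheorem5:
  fixes h :: "real \<Rightarrow> real" and p :: real and A :: "complex^'n^'n"
  assumes universe_large: "\<exists>e :: (nat \<Rightarrow> complex) \<Rightarrow> 'u. inj e"
    and h_antimono: "antimono_on {0<..} h"
    and h_nonneg: "\<And>\<epsilon>. 0 < \<epsilon> \<Longrightarrow> 0 \<le> h \<epsilon>"
    and h_zero: "\<And>\<epsilon>. 1 \<le> \<epsilon> \<Longrightarrow> h \<epsilon> = 0"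
    and h_approx: "\<And>(H :: 'u hilbert) L B \<epsilon>.
      \<lbrakk>complex_hilbert H; unital_cstar_algebra H L; real_rank_zero H L;
       B \<in> L; op_norm H B \<le> 1; condition_C H L B; 0 < \<epsilon>\<rbrakk> \<Longrightarrow>
      \<exists>T \<in> op_ball H L (op_norm H B) \<inter> normals H L.
      \<exists>R \<in> op_scale H (of_real (h \<epsilon>)) ` M_hull H L (op_commutator H (op_adj H B) B)
             \<inter> selfadjoints H L.
      \<exists>E \<in> op_ball H L \<epsilon>. B = op_add H (op_add H T R) E"
    and p: "1 \<le> p"
    and A: "mat_norm A \<le> 1"
  shows "(INF T\<in>normal_mats. mat_norm (A - T))
           \<le> (INF T\<in>{T \<in> normal_mats. mat_norm T \<le> mat_norm A}. mat_norm (A - T))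
       \<and> (INF T\<in>{T \<in> normal_mats. mat_norm T \<le> mat_norm A}. mat_norm (A - T))
           \<le> F_of h (mat_norm (cadj A ** A - A ** cadj A))
       \<and> (INF T\<in>normal_mats. schatten_norm p (A - T))
           \<le> (INF T\<in>{T \<in> normal_mats. mat_norm T \<le> mat_norm A}. schatten_norm p (A - T))
       \<and> (INF T\<in>{T \<in> normal_mats. mat_norm T \<le> mat_norm A}. schatten_norm p (A - T))
           \<le> real CARD('n) powr (1 / p)
             * F_of h (real CARD('n) powr (- 1 / p)
                 * schatten_norm p (cadj A ** A - A ** cadj A))"
proof -
  define C where "C = cadj A ** A - A ** cadj A"
  define N :: "(complex^'n^'n) set" where "N = {T \<in> normal_mats. mat_norm T \<le> mat_norm A}"
  define m where "m = real CARD('n) powr (1 / p)"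
  have m: "0 < m"
    by (simp add: m_def)
  obtain e :: "(nat \<Rightarrow> complex) \<Rightarrow> 'u" where e: "inj e"
    using universe_large by blast
  obtain f :: "'n \<Rightarrow> nat" where f: "inj f"
    using finite_imp_inj_to_nat_seg[OF finite_class.finite_UNIV] by blast
  \<comment> \<open>A vector becomes a sequence in which every coordinate occurs, since \<open>inv f\<close> is onto.\<close>
  define j :: "complex^'n \<Rightarrow> 'u" where "j x = e (\<lambda>k. x $ inv f k)" for x
  have "inj j"
  proof (rule injI)
    fix x y assume "j x = j y"
    then have "(\<lambda>k. x $ inv f k) = (\<lambda>k. y $ inv f k)"
      using e by (simp add: j_def inj_eq)
    then have "x $ inv f (f i) = y $ inv f (f i)" for i
      by (rule fun_cong)
    then show "x = y"
      using f by (simp add: vec_eq_iff)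
  qed
  then interpret coordinate_copy j
    by unfold_locales
  have approx: "\<exists>T\<in>N. mat_norm (A - T) \<le> h \<epsilon> * mat_norm C + \<epsilon>
      \<and> schatten_norm p (A - T) \<le> h \<epsilon> * schatten_norm p C + m * \<epsilon>" if \<epsilon>: "0 < \<epsilon>" for \<epsilon>
  proof -
    have "op_of A \<in> range op_of" "op_norm hilb (op_of A) \<le> 1"
      using A by simp_all
    from h_approx[OF complex_hilbert_hilb unital_cstar_algebra_hilb real_rank_zero_hilb this
        condition_C_hilb \<epsilon>]
    obtain T R E
      where T: "T \<in> op_ball hilb (range op_of) (op_norm hilb (op_of A)) \<inter> normals hilb (range op_of)"
        and R: "R \<in> op_scale hilb (of_real (h \<epsilon>))
          ` M_hull hilb (range op_of) (op_commutator hilb (op_adj hilb (op_of A)) (op_of A))"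
        and E: "E \<in> op_ball hilb (range op_of) \<epsilon>"
        and sum: "op_of A = op_add hilb (op_add hilb T R) E"
      by blast
    obtain T' where T': "T = op_of T'" "T' \<in> N"
      using T by (auto simp: op_ball_hilb normals_hilb N_def)
    obtain E' where E': "E = op_of E'" "mat_norm E' \<le> \<epsilon>"
      using E by (auto simp: op_ball_hilb)
    obtain Q where Q: "R = op_scale hilb (of_real (h \<epsilon>)) Q" "Q \<in> M_hull hilb (range op_of) (op_of C)"
      using R by (auto simp: C_def)
    obtain X where X: "Q = op_of X" "mat_norm X \<le> mat_norm C" "schatten_norm p X \<le> schatten_norm p C"
      using M_hull_hilb[OF Q(2) p] by blast
    have "A = T' + h \<epsilon> *\<^sub>R X + E'"
      using sum by (simp add: T' E' Q X mat_of_real_mult)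
    then have AT: "A - T' = h \<epsilon> *\<^sub>R X + E'"
      by simp
    have "mat_norm (A - T') \<le> h \<epsilon> * mat_norm X + mat_norm E'"
      unfolding AT using mat_norm_triangle[of "h \<epsilon> *\<^sub>R X" E'] h_nonneg[OF \<epsilon>]
      by (simp add: mat_norm_scaleR)
    also have "\<dots> \<le> h \<epsilon> * mat_norm C + \<epsilon>"
      by (intro add_mono mult_left_mono X E' h_nonneg \<epsilon>)
    finally have 1: "mat_norm (A - T') \<le> h \<epsilon> * mat_norm C + \<epsilon>" .
    have "schatten_norm p (A - T') \<le> schatten_norm p (h \<epsilon> *\<^sub>R X) + schatten_norm p E'"
      unfolding AT by (rule schatten_norm_triangle[OF p])
    also have "\<dots> \<le> h \<epsilon> * schatten_norm p X + m * mat_norm E'"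
      unfolding m_def
      by (intro add_mono schatten_norm_scaleR_le schatten_norm_le_mat_norm p h_nonneg \<epsilon>)
    also have "\<dots> \<le> h \<epsilon> * schatten_norm p C + m * \<epsilon>"
      using m by (intro add_mono mult_left_mono X E' h_nonneg \<epsilon>) simp
    finally have "schatten_norm p (A - T') \<le> h \<epsilon> * schatten_norm p C + m * \<epsilon>" .
    with 1 T'(2) show ?thesis
      by blast
  qed
  have N: "N \<noteq> {}" "N \<subseteq> normal_mats"
    using approx[OF zero_less_one] by (auto simp: N_def)
  have bdd: "bdd_below (g ` S)" if "\<And>T. 0 \<le> g T" for g :: "complex^'n^'n \<Rightarrow> real" and S
    using that by (intro bdd_belowI2[where m = 0])
  note bdd_op = bdd[OF mat_norm_nonneg] and bdd_p = bdd[OF schatten_norm_nonneg]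
  have "(INF T\<in>normal_mats. mat_norm (A - T)) \<le> (INF T\<in>N. mat_norm (A - T))"
    using N by (intro cINF_superset_mono bdd_op) auto
  moreover have "(INF T\<in>normal_mats. schatten_norm p (A - T)) \<le> (INF T\<in>N. schatten_norm p (A - T))"
    using N by (intro cINF_superset_mono bdd_p) auto
  moreover have "(INF T\<in>N. mat_norm (A - T)) \<le> F_of h (mat_norm C)"
    unfolding F_of_def
  proof (rule cINF_greatest)
    fix \<epsilon> :: real assume "\<epsilon> \<in> {0<..}"
    then obtain T where "T \<in> N" "mat_norm (A - T) \<le> h \<epsilon> * mat_norm C + \<epsilon>"
      using approx by auto
    then show "(INF T\<in>N. mat_norm (A - T)) \<le> h \<epsilon> * mat_norm C + \<epsilon>"
      by (rule cINF_lower2[OF bdd_op])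
  qed auto
  moreover have "(INF T\<in>N. schatten_norm p (A - T)) \<le> m * F_of h (real CARD('n) powr (- 1 / p) * schatten_norm p C)"
  proof -
    have "(INF T\<in>N. schatten_norm p (A - T)) / m
        \<le> F_of h (real CARD('n) powr (- 1 / p) * schatten_norm p C)"
      unfolding F_of_def
    proof (rule cINF_greatest)
      fix \<epsilon> :: real assume "\<epsilon> \<in> {0<..}"
      then obtain T where T: "T \<in> N" "schatten_norm p (A - T) \<le> h \<epsilon> * schatten_norm p C + m * \<epsilon>"
        using approx by auto
      then have "(INF T\<in>N. schatten_norm p (A - T)) \<le> h \<epsilon> * schatten_norm p C + m * \<epsilon>"
        by (rule cINF_lower2[OF bdd_p])
      then have "(INF T\<in>N. schatten_norm p (A - T)) / m \<le> (h \<epsilon> * schatten_norm p C + m * \<epsilon>) / m"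
        using m by (intro divide_right_mono) simp_all
      also have "\<dots> = h \<epsilon> * (schatten_norm p C / m) + \<epsilon>"
        using m by (simp add: add_divide_distrib)
      also have "schatten_norm p C / m = real CARD('n) powr (- 1 / p) * schatten_norm p C"
        by (simp add: m_def powr_minus_divide)
      finally show "(INF T\<in>N. schatten_norm p (A - T)) / m
          \<le> h \<epsilon> * (real CARD('n) powr (- 1 / p) * schatten_norm p C) + \<epsilon>" .
    qed auto
    then show ?thesis
      using m by (simp add: pos_divide_le_eq mult.commute)
  qed
  ultimately show ?thesis
    unfolding N_def[symmetric] C_def[symmetric] m_def[symmetric] by blast
qed

end
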